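(* Given $k \in \{2,\dots, n\}$ and constants $\varepsilon, \mu > 0$, there exists a constant $\gamma > 0$, and parameters $\Delta = \Theta(\frac{\log k}{\varepsilon^2})$ and $l = \Theta(\frac{\log n}{\log \Delta})$ such that there is an instance $\hat{D}$ of Max-$k$-Ordering on $n$ vertices, with underlying undirected multigraph $\hat{G}$, with the following properties: (i) Low integral optimum: $Opt(\hat{D}) \leq \frac{1}{2}(1 - \frac{1}{k}) + \varepsilon$. (ii) Almost regularity: the maximum degree of $\hat{G}$ is at most $2 \Delta$, and $\hat{G}$ has $\Omega(\Delta n)$ edges. (iii) Local sparsity: for $t < n^{\gamma/\log \Delta}$, every induced subgraph of $\hat{G}$ on $(2 \Delta)^l t$ vertices is $l$-path decomposable. (iv) Large noise: for $t < n^{\gamma/\log \Delta}$, $(1-\mu)^{l/10} \leq \frac{\mu}{5t}$. Note that $n^{\gamma/\log \Delta} = n^{\Omega(1/\log\log k)}$.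
   Context: Max-$k$-Ordering: find $\ell:V\to[k]$ maximizing the weighted fraction of edges $(u,v)$ with $\ell(u)<\ell(v)$; $Opt$ denotes its optimum. The undirected multigraph underlying a digraph replaces each directed edge by an undirected one (so $(u,v)$ and $(v,u)$ give two parallel edges). A graph $G$ is $l$-path decomposable if every 2-connected subgraph $H$ of $G$ contains a path of length $l$ such that every vertex of the path has degree 2 in $H$.
   Formalization: Proved for n sufficiently large in terms of ε and μ (it fails for n = k = 2 and small ε) and for μ ≤ 1 (otherwise the power of 1−μ is undefined); the Θ and Ω constants are uniform for ε in any bounded range; the closing remark is for k ≥ 3. *)

theory Defs
  imports Complex_Main "HOL-Library.FuncSet" "Graph_Theory.Pair_Digraph"
begin

section \<open>Max-$k$-Ordering\<close>

text \<open>
  An instance is a finite loop-free digraph with arc weights. The weights are strictly positive,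
  so that an arc of the digraph cannot be present in the degree and sparsity conditions while being
  invisible to the objective.
\<close>

definition ordering_instance :: "'a pair_pre_digraph \<Rightarrow> ('a \<times> 'a \<Rightarrow> real) \<Rightarrow> bool" where
  "ordering_instance D w \<longleftrightarrow> pair_digraph D \<and> (\<forall>e \<in> parcs D. 0 < w e)"

definition ordering_value ::
  "'a pair_pre_digraph \<Rightarrow> ('a \<times> 'a \<Rightarrow> real) \<Rightarrow> ('a \<Rightarrow> nat) \<Rightarrow> real" where
  "ordering_value D w f =
     (\<Sum>e \<in> {e \<in> parcs D. f (fst e) < f (snd e)}. w e) / (\<Sum>e \<in> parcs D. w e)"

definition ordering_opt :: "nat \<Rightarrow> 'a pair_pre_digraph \<Rightarrow> ('a \<times> 'a \<Rightarrow> real) \<Rightarrow> real" where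
  "ordering_opt k D w = Max (ordering_value D w ` (pverts D \<rightarrow>\<^sub>E {1..k}))"


section \<open>Undirected multigraphs\<close>

record ('a, 'e) multigraph =
  mverts :: "'a set"
  medges :: "'e set"
  mends :: "'e \<Rightarrow> 'a set"

definition wf_multigraph :: "('a, 'e) multigraph \<Rightarrow> bool" where
  "wf_multigraph G \<longleftrightarrow> finite (mverts G) \<and> finite (medges G) \<and>
     (\<forall>e \<in> medges G. mends G e \<subseteq> mverts G \<and> card (mends G e) = 2)"

text \<open>
  The edges of the underlying multigraph are the arcs themselves, so the antiparallel arcs
  $(u,v)$ and $(v,u)$ remain two distinct edges with the same ends.
\<close>

definition underlying_multigraph :: "'a pair_pre_digraph \<Rightarrow> ('a, 'a \<times> 'a) multigraph" where
  "underlying_multigraph D =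
     \<lparr> mverts = pverts D, medges = parcs D, mends = (\<lambda>e. {fst e, snd e}) \<rparr>"

definition mdegree :: "('a, 'e) multigraph \<Rightarrow> 'a \<Rightarrow> nat" where
  "mdegree G v = card {e \<in> medges G. v \<in> mends G e}"

definition max_mdegree :: "('a, 'e) multigraph \<Rightarrow> nat" where
  "max_mdegree G = Max (mdegree G ` mverts G)"

definition msubgraph :: "('a, 'e) multigraph \<Rightarrow> ('a, 'e) multigraph \<Rightarrow> bool" where
  "msubgraph H G \<longleftrightarrow> wf_multigraph H \<and> mverts H \<subseteq> mverts G \<and> medges H \<subseteq> medges G \<and>
     (\<forall>e \<in> medges H. mends H e = mends G e)"

definition minduced :: "('a, 'e) multigraph \<Rightarrow> 'a set \<Rightarrow> ('a, 'e) multigraph" where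
  "minduced G S =
     \<lparr> mverts = S, medges = {e \<in> medges G. mends G e \<subseteq> S}, mends = mends G \<rparr>"

definition mconnected :: "('a, 'e) multigraph \<Rightarrow> bool" where
  "mconnected G \<longleftrightarrow> mverts G \<noteq> {} \<and>
     (\<forall>u \<in> mverts G. \<forall>v \<in> mverts G. (u, v) \<in> {(x, y). \<exists>e \<in> medges G. mends G e = {x, y}}\<^sup>*)"

text \<open>
  Convention for multigraphs: a single edge is not 2-connected, whereas two vertices joined by
  parallel edges (a cycle of length 2) are. On at least three vertices the condition on the
  number of edges follows from connectedness, and the definition says that $G$ is connected and
  has no cut vertex.
\<close>

definition two_connected :: "('a, 'e) multigraph \<Rightarrow> bool" where
  "two_connected G \<longleftrightarrow> 2 \<le> card (mverts G) \<and> 2 \<le> card (medges G) \<and> mconnected G \<and>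
     (\<forall>v \<in> mverts G. mconnected (minduced G (mverts G - {v})))"

definition mpath :: "('a, 'e) multigraph \<Rightarrow> 'a list \<Rightarrow> 'e list \<Rightarrow> bool" where
  "mpath G vs es \<longleftrightarrow> length vs = Suc (length es) \<and> distinct vs \<and> set vs \<subseteq> mverts G \<and>
     (\<forall>i < length es. es ! i \<in> medges G \<and> mends G (es ! i) = {vs ! i, vs ! Suc i})"

definition path_decomposable :: "nat \<Rightarrow> ('a, 'e) multigraph \<Rightarrow> bool" where
  "path_decomposable l G \<longleftrightarrow>
     (\<forall>H. msubgraph H G \<and> two_connected H \<longrightarrow>
       (\<exists>vs es. mpath H vs es \<and> length es = l \<and> (\<forall>v \<in> set vs. mdegree H v = 2)))"

end

theory Submission
  imports Defs "HOL-Analysis.Analysis" "HOL-Real_Asymp.Real_Asymp"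
begin

text \<open>
  Choose $m = dn$ arcs independently and uniformly from $V \times V$, where $\Delta = 4d$ and
  $d \approx 16 \ln k / \varepsilon^2$. A fixed labelling has at most a fraction
  $\frac12(1-\frac1k)$ of increasing pairs, so a Chernoff bound beats the $k^n$ labellings. A
  first-moment bound excludes vertex sets $S$ of size at most $\Delta^{4l} \le n^{1/25}$ spanning $|S| + x$ arcs
  with $|S| \le x(6l+2)$, and shows that deleting all arcs at vertices of degree above $8d$ and all
  arcs in sets of at most $2l+1$ vertices spanning at least as many arcs costs only an
  $\varepsilon/2$ fraction of the arcs.

  A 2-connected $H$ with $s$ vertices and $s+x$ edges, $x \ge 1$, has at most $2x$ vertices of
  degree other than 2, and these have total degree at most $6x$. Breadth-first search from them
  reaches at most $6x$ new vertices per step, hence some vertex is at distance $l+1$, and a shortest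
  path from it is the required path. If $x = 0$, all degrees are 2 and any vertex serves as the root.
\<close>

section \<open>Long paths of degree-2 vertices in sparse multigraphs\<close>

text \<open>Drawing from all of V x V with replacement keeps the arcs independent, so averages of
  products factor exactly. Loops and repeated arcs then need no separate treatment: they are one
  index on one vertex and two indices on two vertices, hence disappear with the short dense sets.
  Dense sets are treated in two ways because of the power of n in their expected number. An excess
  of x arcs saves a factor n^(-x); with |S| <= x(6l+2) everything else is a power of \<Delta>^l, so
  \<Delta>^(100 l) <= n leaves no such set at all. Without excess the saving is lost. Short cycles
  do occur, and they can only be deleted, at a cost of at most \<Delta>^(8 l) <= n arcs. The length
  l is squeezed from both sides. The condition \<Delta>^(100 l) <= n bounds it above, while the
  noise property needs it proportional to ln n / ln \<Delta>; taking \<gamma> proportional to \<mu>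
  makes the two compatible. The threshold on n must serve every k <= n at once, although \<Delta>
  grows with k.\<close>

lemma mends_pair:
  assumes "wf_multigraph G" "e \<in> medges G" "u \<in> mends G e"
  obtains v where "v \<noteq> u" "v \<in> mverts G" "mends G e = {u, v}"
proof -
  have "card (mends G e) = 2" "mends G e \<subseteq> mverts G"
    using assms unfolding wf_multigraph_def by auto
  then obtain a b where ab: "mends G e = {a, b}" "a \<noteq> b" "a \<in> mverts G" "b \<in> mverts G"
    by (auto simp: card_2_iff)
  show thesis
  proof (cases "u = a")
    case True
    then show thesis using that[of b] ab by simp
  next
    case False
    then show thesis using that[of a] ab assms(3) by (simp add: insert_commute)
  qed
qed

lemma rtrancl_leaves_set:
  assumes "(u, v) \<in> r\<^sup>*" "u \<in> X" "v \<notin> X"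
  shows "\<exists>a b. (a, b) \<in> r \<and> a \<in> X \<and> b \<notin> X"
proof (rule ccontr)
  assume "\<not> ?thesis"
  then have closed: "b \<in> X" if "(a, b) \<in> r" "a \<in> X" for a b
    using that by metis
  from assms(1) have "v \<in> X"
  proof (induction rule: rtrancl_induct)
    case (step y z)
    show ?case by (rule closed[OF step(2,3)])
  qed (rule assms(2))
  with assms(3) show False ..
qed

lemma mconnected_edge_leaving:
  assumes "mconnected G" "X \<inter> mverts G \<noteq> {}" "v \<in> mverts G" "v \<notin> X"
  obtains e a b where "e \<in> medges G" "mends G e = {a, b}" "a \<in> X" "b \<notin> X"
proof -
  obtain u where "u \<in> X" "u \<in> mverts G" using assms(2) by blast
  then have "(u, v) \<in> {(x, y). \<exists>e \<in> medges G. mends G e = {x, y}}\<^sup>*"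
    using assms(1,3) unfolding mconnected_def by blast
  from rtrancl_leaves_set[OF this \<open>u \<in> X\<close> assms(4)] that show thesis by blast
qed

lemma sum_mdegree:
  assumes "wf_multigraph G"
  shows "(\<Sum>v\<in>mverts G. mdegree G v) = 2 * card (medges G)"
proof -
  have fin: "finite (mverts G)" "finite (medges G)"
    and ends: "\<And>e. e \<in> medges G \<Longrightarrow> mends G e \<subseteq> mverts G \<and> card (mends G e) = 2"
    using assms unfolding wf_multigraph_def by auto
  have "(\<Sum>v\<in>mverts G. mdegree G v) = (\<Sum>v\<in>mverts G. \<Sum>e\<in>medges G. of_bool (v \<in> mends G e))"
    unfolding mdegree_def using fin by (simp add: Int_def)
  also have "\<dots> = (\<Sum>e\<in>medges G. \<Sum>v\<in>mverts G. of_bool (v \<in> mends G e))"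
    by (rule sum.swap)
  also have "\<dots> = (\<Sum>e\<in>medges G. 2)"
  proof (rule sum.cong[OF refl])
    fix e assume "e \<in> medges G"
    then have "mverts G \<inter> mends G e = mends G e" using ends by blast
    then show "(\<Sum>v\<in>mverts G. of_bool (v \<in> mends G e)) = (2 :: nat)"
      using fin ends \<open>e \<in> medges G\<close> by (simp add: Int_def)
  qed
  finally show ?thesis by simp
qed

text \<open>Connectedness gives an edge from v to some u. If there is a third vertex, deleting u
  leaves v connected to it, which yields a second edge avoiding u. On two vertices all edges are
  parallel and the clause \<open>2 \<le> card (medges G)\<close> supplies the second one.\<close>

lemma two_connected_mdegree_ge_2:
  assumes wf: "wf_multigraph G" and two: "two_connected G" and v: "v \<in> mverts G"
  shows "2 \<le> mdegree G v"
proof -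
  have finE: "finite (medges G)" and finV: "finite (mverts G)"
    using wf unfolding wf_multigraph_def by auto
  have conn: "mconnected G" and cV: "2 \<le> card (mverts G)" and cE: "2 \<le> card (medges G)"
    using two unfolding two_connected_def by auto
  have "mverts G \<noteq> {v}" using cV by auto
  then obtain z where "z \<in> mverts G" "z \<notin> {v}" using v by blast
  with mconnected_edge_leaving[OF conn, of "{v}" z] v
  obtain e u where e: "e \<in> medges G" "mends G e = {v, u}" "u \<noteq> v" by blast
  have u: "u \<in> mverts G" using wf e unfolding wf_multigraph_def by auto
  show ?thesis
  proof (cases "mverts G = {u, v}")
    case True
    have "v \<in> mends G e'" if "e' \<in> medges G" for e'
    proof -
      have "card (mends G e') = 2" "mends G e' \<subseteq> {u, v}"
        using wf that True unfolding wf_multigraph_def by auto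
      then have "mends G e' = {u, v}"
        using e(3) card_subset_eq[of "{u,v}" "mends G e'"] by simp
      then show ?thesis by simp
    qed
    then have "{e' \<in> medges G. v \<in> mends G e'} = medges G" by blast
    then show ?thesis using cE unfolding mdegree_def by simp
  next
    case False
    then obtain w where w: "w \<in> mverts G" "w \<noteq> u" "w \<noteq> v" using u v by blast
    have "mconnected (minduced G (mverts G - {u}))"
      using two u unfolding two_connected_def by blast
    from mconnected_edge_leaving[OF this, of "{v}" w] v w e(3)
    obtain e' a b where "e' \<in> medges (minduced G (mverts G - {u}))"
      "mends (minduced G (mverts G - {u})) e' = {a, b}" "a \<in> {v}" "b \<notin> {v}"
      by (auto simp: minduced_def)
    then have e': "e' \<in> medges G" "mends G e' = {v, b}" "u \<notin> mends G e'"
      by (auto simp: minduced_def)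
    have "{e, e'} \<subseteq> {e \<in> medges G. v \<in> mends G e}" using e e' by auto
    moreover have "e \<noteq> e'" using e e' by auto
    then have "card {e, e'} = 2" by simp
    ultimately show ?thesis unfolding mdegree_def
      using card_mono[of "{e \<in> medges G. v \<in> mends G e}" "{e, e'}"] finE by simp
  qed
qed

section \<open>Breadth-first balls and their boundaries\<close>

primrec mball :: "('a, 'e) multigraph \<Rightarrow> 'a set \<Rightarrow> nat \<Rightarrow> 'a set" where
  "mball G R 0 = R"
| "mball G R (Suc i) = mball G R i \<union> {v. \<exists>e\<in>medges G. \<exists>u\<in>mball G R i. mends G e = {u, v}}"

definition mboundary :: "('a, 'e) multigraph \<Rightarrow> 'a set \<Rightarrow> 'e set" where
  "mboundary G X = {e \<in> medges G. mends G e \<inter> X \<noteq> {} \<and> \<not> mends G e \<subseteq> X}"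

lemma mball_mono: "i \<le> j \<Longrightarrow> mball G R i \<subseteq> mball G R j"
proof (induction j)
  case (Suc j)
  then show ?case by (cases "i = Suc j") (simp_all add: le_Suc_eq subset_iff)
qed simp

lemma mball_subset_mverts:
  assumes "wf_multigraph G" "R \<subseteq> mverts G"
  shows "mball G R i \<subseteq> mverts G"
proof (induction i)
  case (Suc i)
  moreover have "v \<in> mverts G" if "e \<in> medges G" "mends G e = {u, v}" for e u v
    using assms(1) that unfolding wf_multigraph_def by blast
  ultimately show ?case by auto
qed (simp add: assms)

lemma mends_subset_mball_Suc:
  assumes "wf_multigraph G" "e \<in> medges G" "mends G e \<inter> mball G R i \<noteq> {}"
  shows "mends G e \<subseteq> mball G R (Suc i)"
proof -
  obtain u where u: "u \<in> mends G e" "u \<in> mball G R i" using assms(3) by blast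
  from mends_pair[OF assms(1,2) u(1)] obtain v where "mends G e = {u, v}" .
  then show ?thesis using u assms(2) by auto
qed

text \<open>Assign to each new vertex an edge that reaches it from the ball. The assignment is
  injective because a boundary edge has one end inside the ball and hence only one outside.\<close>

lemma card_mball_layer_le_boundary:
  assumes wf: "wf_multigraph G"
  shows "card (mball G R (Suc i) - mball G R i) \<le> card (mboundary G (mball G R i))"
proof -
  let ?B = "mball G R i"
  have fin: "finite (mboundary G ?B)"
    using wf unfolding wf_multigraph_def mboundary_def by auto
  have "\<exists>e. e \<in> mboundary G ?B \<and> v \<in> mends G e" if "v \<in> mball G R (Suc i) - ?B" for v
    using that by (fastforce simp: mboundary_def)
  then obtain f where f: "\<And>v. v \<in> mball G R (Suc i) - ?B \<Longrightarrow> f v \<in> mboundary G ?B \<and> v \<in> mends G (f v)"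
    by metis
  have "inj_on f (mball G R (Suc i) - ?B)"
  proof (rule inj_onI)
    fix v w assume v: "v \<in> mball G R (Suc i) - ?B" and w: "w \<in> mball G R (Suc i) - ?B" and eq: "f v = f w"
    obtain x where x: "x \<in> mends G (f v)" "x \<in> ?B" and fe: "f v \<in> medges G"
      using f[OF v] unfolding mboundary_def by blast
    from mends_pair[OF wf fe x(1)] obtain y where "mends G (f v) = {x, y}" .
    then show "v = w" using f[OF v] f[OF w] eq v w x by auto
  qed
  moreover have "f ` (mball G R (Suc i) - ?B) \<subseteq> mboundary G ?B" using f by blast
  ultimately show ?thesis using fin by (rule card_inj_on_le)
qed

text \<open>
  A vertex of the new layer has degree 2 and one of its edges leads back into the old ball,
  so it sends at most one edge outwards.
\<close>

lemma card_mboundary_mball_le_layer: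
  assumes wf: "wf_multigraph G" and R: "R \<subseteq> mverts G"
    and deg: "\<And>v. v \<in> mverts G - R \<Longrightarrow> mdegree G v = 2"
  shows "card (mboundary G (mball G R (Suc i))) \<le> card (mball G R (Suc i) - mball G R i)"
proof -
  let ?B = "mball G R i" and ?B' = "mball G R (Suc i)"
  have finV: "finite (mverts G)" and finE: "finite (medges G)"
    using wf unfolding wf_multigraph_def by auto
  have fin: "finite (?B' - ?B)"
    using mball_subset_mverts[OF wf R] finV by (meson finite_Diff finite_subset)
  have "\<exists>u. u \<in> ?B' - ?B \<and> u \<in> mends G e" if "e \<in> mboundary G ?B'" for e
    using that mends_subset_mball_Suc[OF wf, of e R i] unfolding mboundary_def by blast
  then obtain f where f: "\<And>e. e \<in> mboundary G ?B' \<Longrightarrow> f e \<in> ?B' - ?B \<and> f e \<in> mends G e"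
    by metis
  have "inj_on f (mboundary G ?B')"
  proof (rule inj_onI, rule ccontr)
    fix e e' assume e: "e \<in> mboundary G ?B'" and e': "e' \<in> mboundary G ?B'"
      and eq: "f e = f e'" and ne: "e \<noteq> e'"
    let ?u = "f e"
    have u: "?u \<in> ?B'" "?u \<notin> ?B" "?u \<in> mends G e" "?u \<in> mends G e'"
      using f[OF e] f[OF e'] eq by auto
    then obtain e0 w where e0: "e0 \<in> medges G" "w \<in> ?B" "mends G e0 = {w, ?u}" by auto
    have "mends G e0 \<subseteq> ?B'" using e0 u by auto
    then have "e0 \<noteq> e" "e0 \<noteq> e'" using e e' unfolding mboundary_def by auto
    then have "card {e0, e, e'} = 3" using ne by simp
    moreover have "{e0, e, e'} \<subseteq> {e \<in> medges G. ?u \<in> mends G e}"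
      using e0 u e e' unfolding mboundary_def by auto
    ultimately have "3 \<le> mdegree G ?u" unfolding mdegree_def
      using card_mono[of "{e \<in> medges G. ?u \<in> mends G e}" "{e0, e, e'}"] finE by simp
    moreover have "?u \<notin> R" using u(2) mball_mono[of 0 i G R] by auto
    moreover have "?u \<in> mverts G" using mball_subset_mverts[OF wf R] u(1) by blast
    ultimately show False using deg[of ?u] by simp
  qed
  moreover have "f ` mboundary G ?B' \<subseteq> ?B' - ?B" using f by blast
  ultimately show ?thesis using fin by (rule card_inj_on_le)
qed

text \<open>Outside R every vertex has degree 2, so the boundary never grows: layer <= old boundary
  and new boundary <= layer. It starts with at most the total degree of R, which therefore bounds
  each layer.\<close>

lemma card_mball_le:
  assumes wf: "wf_multigraph G" and R: "R \<subseteq> mverts G"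
    and deg: "\<And>v. v \<in> mverts G - R \<Longrightarrow> mdegree G v = 2"
  shows "card (mball G R i) \<le> card R + i * (\<Sum>v\<in>R. mdegree G v)"
proof -
  have finV: "finite (mverts G)" and finE: "finite (medges G)"
    using wf unfolding wf_multigraph_def by auto
  have bdry: "card (mboundary G (mball G R i)) \<le> (\<Sum>v\<in>R. mdegree G v)" for i
  proof (induction i)
    case 0
    have "mboundary G R \<subseteq> (\<Union>v\<in>R. {e \<in> medges G. v \<in> mends G e})"
      unfolding mboundary_def by blast
    then have "card (mboundary G R) \<le> card (\<Union>v\<in>R. {e \<in> medges G. v \<in> mends G e})"
      using finE finV R by (intro card_mono) (auto dest: finite_subset)
    also have "\<dots> \<le> (\<Sum>v\<in>R. mdegree G v)"
      unfolding mdegree_def using finV R by (intro card_UN_le) (auto dest: finite_subset)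
    finally show ?case by simp
  next
    case (Suc i)
    then show ?case
      using card_mboundary_mball_le_layer[OF wf R deg, of i] card_mball_layer_le_boundary[OF wf, of R i]
      by linarith
  qed
  show ?thesis
  proof (induction i)
    case (Suc i)
    have "mball G R (Suc i) = mball G R i \<union> (mball G R (Suc i) - mball G R i)" by auto
    then have "card (mball G R (Suc i)) \<le> card (mball G R i) + card (mball G R (Suc i) - mball G R i)"
      by (metis card_Un_le)
    then show ?case
      using Suc bdry[of i] card_mball_layer_le_boundary[OF wf, of R i] by simp
  qed simp
qed

text \<open>Step backwards from v, one layer at a time, stopping in layer 1 so that R is never
  entered; this gives l + 1 vertices and l edges. The containment in the ball is carried through the
  induction because it makes the prepended vertex new, hence the path simple.\<close>

lemma mpath_through_layers:
  assumes wf: "wf_multigraph G" and R: "R \<subseteq> mverts G"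
    and v: "v \<in> mball G R (Suc l) - mball G R l"
  shows "\<exists>vs es. mpath G vs es \<and> length es = l \<and> set vs \<subseteq> mverts G - R \<and> hd vs = v
           \<and> set vs \<subseteq> mball G R (Suc l)"
  using v
proof (induction l arbitrary: v)
  case 0
  then have "mpath G [v] [] \<and> length ([] :: 'b list) = 0 \<and> set [v] \<subseteq> mverts G - R \<and> hd [v] = v
     \<and> set [v] \<subseteq> mball G R (Suc 0)"
    using mball_subset_mverts[OF wf R, of "Suc 0"] unfolding mpath_def by auto
  then show ?case by blast
next
  case (Suc l)
  then obtain e u where e: "e \<in> medges G" "u \<in> mball G R (Suc l)" "mends G e = {u, v}"
    by auto
  have "u \<notin> mball G R l"
  proof
    assume "u \<in> mball G R l"
    then have "v \<in> mball G R (Suc l)" using e by auto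
    then show False using Suc.prems by simp
  qed
  with Suc.IH e(2) obtain vs es where P: "mpath G vs es" "length es = l" "set vs \<subseteq> mverts G - R"
    "hd vs = u" "set vs \<subseteq> mball G R (Suc l)" by blast
  have v: "v \<in> mverts G" using mball_subset_mverts[OF wf R] Suc.prems by blast
  have "v \<notin> R" using Suc.prems mball_mono[of 0 "Suc l" G R] by auto
  have "v \<notin> set vs" using P(5) Suc.prems by blast
  have len: "length vs = Suc l" using P unfolding mpath_def by simp
  then have "vs ! 0 = u" using P(4) by (cases vs) auto
  have "(e # es) ! i \<in> medges G \<and> mends G ((e # es) ! i) = {(v # vs) ! i, (v # vs) ! Suc i}"
    if "i < length (e # es)" for i
    using that P(1) e \<open>vs ! 0 = u\<close> by (cases i) (auto simp: mpath_def)
  then have "mpath G (v # vs) (e # es)"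
    using P(1) v \<open>v \<notin> set vs\<close> unfolding mpath_def by auto
  moreover have "set (v # vs) \<subseteq> mball G R (Suc (Suc l))"
    using P(5) Suc.prems by auto
  ultimately show ?case using P(2,3) v \<open>v \<notin> R\<close>
    by (intro exI[of _ "v # vs"] exI[of _ "e # es"]) auto
qed

text \<open>The ball of radius l misses a vertex by counting, so connectedness gives an edge leaving
  it and layer l + 1 is inhabited.\<close>

lemma long_path_avoiding:
  assumes wf: "wf_multigraph G" and conn: "mconnected G" and R: "R \<subseteq> mverts G" "R \<noteq> {}"
    and deg: "\<And>v. v \<in> mverts G - R \<Longrightarrow> mdegree G v = 2"
    and large: "card R + l * (\<Sum>v\<in>R. mdegree G v) < card (mverts G)"
  shows "\<exists>vs es. mpath G vs es \<and> length es = l \<and> set vs \<subseteq> mverts G - R"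
proof -
  have "card (mball G R l) < card (mverts G)"
    using card_mball_le[OF wf R(1) deg, of l] large by simp
  then obtain w where "w \<in> mverts G" "w \<notin> mball G R l"
    using mball_subset_mverts[OF wf R(1), of l] by (metis nat_neq_iff subsetI subset_antisym)
  moreover have "mball G R l \<inter> mverts G \<noteq> {}" using R mball_mono[of 0 l G R] by auto
  ultimately obtain e a b where "e \<in> medges G" "mends G e = {a, b}" "a \<in> mball G R l" "b \<notin> mball G R l"
    using mconnected_edge_leaving[OF conn] by metis
  then have "b \<in> mball G R (Suc l) - mball G R l" by auto
  from mpath_through_layers[OF wf R(1) this] show ?thesis by blast
qed

section \<open>Sparse 2-connected multigraphs\<close>

text \<open>With excess x, the handshake identity says that deg(v) - 2 sums to 2x over B. Each term
  is at least 1, so |B| <= 2x and the degrees in B sum to 2x + 2|B| <= 6x. Hence |B| + l * 6x <=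
  x(6l+2), which is the origin of this constant; a single root of degree 2 gives 2l + 1
  instead.\<close>

lemma degree_2_path_of_few_edges:
  assumes wf: "wf_multigraph G" and two: "two_connected G"
    and cycle: "card (medges G) = card (mverts G) \<Longrightarrow> 2 * l + 1 < card (mverts G)"
    and excess: "\<And>x. 1 \<le> x \<Longrightarrow> card (medges G) = card (mverts G) + x \<Longrightarrow>
      x * (6 * l + 2) < card (mverts G)"
  shows "\<exists>vs es. mpath G vs es \<and> length es = l \<and> (\<forall>v\<in>set vs. mdegree G v = 2)"
proof -
  let ?V = "mverts G"
  have finV: "finite ?V" using wf unfolding wf_multigraph_def by auto
  have conn: "mconnected G" using two unfolding two_connected_def by simp
  have deg2: "\<And>v. v \<in> ?V \<Longrightarrow> 2 \<le> mdegree G v" using two_connected_mdegree_ge_2[OF wf two] .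
  define B where "B = {v \<in> ?V. mdegree G v \<noteq> 2}"
  have finB: "finite B" and BV: "B \<subseteq> ?V" using finV unfolding B_def by auto
  have split: "(\<Sum>v\<in>?V. mdegree G v) = (\<Sum>v\<in>B. mdegree G v) + 2 * card (?V - B)"
  proof -
    have "(\<Sum>v\<in>?V - B. mdegree G v) = 2 * card (?V - B)" unfolding B_def by simp
    then show ?thesis using sum.subset_diff[OF BV finV, of "mdegree G"] by simp
  qed
  have cards: "card (?V - B) + card B = card ?V"
    using card_Diff_subset[OF finB BV] card_mono[OF finV BV] by simp
  have "3 \<le> mdegree G v" if "v \<in> B" for v using deg2[of v] that unfolding B_def by auto
  then have B3: "3 * card B \<le> (\<Sum>v\<in>B. mdegree G v)"
    using sum_bounded_below[of B 3 "mdegree G"] by simp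
  have hand: "(\<Sum>v\<in>B. mdegree G v) + 2 * card (?V - B) = 2 * card (medges G)"
    using sum_mdegree[OF wf] split by simp
  have "\<exists>R \<subseteq> ?V. B \<subseteq> R \<and> R \<noteq> {} \<and> card R + l * (\<Sum>v\<in>R. mdegree G v) < card ?V"
  proof (cases "B = {}")
    case True
    then have "card (medges G) = card ?V" using hand by simp
    then have big: "2 * l + 1 < card ?V" using cycle by simp
    then obtain r where r: "r \<in> ?V" by fastforce
    then have "mdegree G r = 2" using True unfolding B_def by blast
    then have "card {r} + l * (\<Sum>v\<in>{r}. mdegree G v) < card ?V" using big by simp
    then show ?thesis using r True by blast
  next
    case False
    then have "card B > 0" using finB by (simp add: card_gt_0_iff)
    \<comment> \<open>The truncated subtraction is exact: degrees of at least 3 on the nonempty set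
      B force strictly more edges than vertices.\<close>
    define x where "x = card (medges G) - card ?V"
    have x: "card (medges G) = card ?V + x" "1 \<le> x"
      using hand cards B3 \<open>card B > 0\<close> unfolding x_def by linarith+
    have bx: "card B \<le> 2 * x" and sx: "(\<Sum>v\<in>B. mdegree G v) \<le> 6 * x"
      using hand cards B3 x by linarith+
    have "card B + l * (\<Sum>v\<in>B. mdegree G v) \<le> 2 * x + l * (6 * x)"
      by (intro add_mono bx mult_mono sx) auto
    also have "\<dots> = x * (6 * l + 2)" by (simp add: algebra_simps)
    also have "\<dots> < card ?V" using excess[OF x(2,1)] .
    finally show ?thesis using BV False by blast
  qed
  then obtain R where R: "R \<subseteq> ?V" "B \<subseteq> R" "R \<noteq> {}" "card R + l * (\<Sum>v\<in>R. mdegree G v) < card ?V"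
    by blast
  have "\<And>v. v \<in> ?V - R \<Longrightarrow> mdegree G v = 2" using R(2) unfolding B_def by blast
  from long_path_avoiding[OF wf conn R(1,3) this R(4)]
  show ?thesis using R(2) unfolding B_def by blast
qed

text \<open>A subgraph H of the induced multigraph need not itself be induced, so the sparsity
  hypotheses range over every W inside S and every arc set F within W x W, not only over all arcs
  spanned by W.\<close>

lemma path_decomposable_of_sparse:
  fixes D :: "'a pair_pre_digraph"
  assumes fin: "finite (parcs D)"
    and S: "S \<subseteq> pverts D" 
    and cycle: "\<And>W F. W \<subseteq> S \<Longrightarrow> W \<noteq> {} \<Longrightarrow> F \<subseteq> parcs D \<Longrightarrow> F \<subseteq> W \<times> W \<Longrightarrow> card F = card W \<Longrightarrow>
      2 * l + 1 < card W"
    and excess: "\<And>W F x. W \<subseteq> S \<Longrightarrow> W \<noteq> {} \<Longrightarrow> F \<subseteq> parcs D \<Longrightarrow> F \<subseteq> W \<times> W \<Longrightarrow> 1 \<le> x \<Longrightarrow>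
      card F = card W + x \<Longrightarrow> x * (6 * l + 2) < card W"
  shows "path_decomposable l (minduced (underlying_multigraph D) S)"
  unfolding path_decomposable_def
proof (intro allI impI)
  fix H :: "('a, 'a \<times> 'a) multigraph"
  let ?G = "minduced (underlying_multigraph D) S"
  assume "msubgraph H ?G \<and> two_connected H"
  then have H: "msubgraph H ?G" and two: "two_connected H" by auto
  have wf: "wf_multigraph H" and W: "mverts H \<subseteq> S" and F: "medges H \<subseteq> parcs D"
    using H unfolding msubgraph_def minduced_def underlying_multigraph_def by auto
  have ends: "mends H e = {fst e, snd e}" if "e \<in> medges H" for e
    using H that unfolding msubgraph_def minduced_def underlying_multigraph_def by auto
  have FW: "medges H \<subseteq> mverts H \<times> mverts H"
  proof
    fix e assume e: "e \<in> medges H"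
    then have "mends H e \<subseteq> mverts H" using wf unfolding wf_multigraph_def by blast
    then show "e \<in> mverts H \<times> mverts H" using ends[OF e] by (cases e) auto
  qed
  have ne: "mverts H \<noteq> {}" using two unfolding two_connected_def by auto
  show "\<exists>vs es. mpath H vs es \<and> length es = l \<and> (\<forall>v\<in>set vs. mdegree H v = 2)"
    using cycle[OF W ne F FW] excess[OF W ne F FW] by (intro degree_2_path_of_few_edges wf two) auto
qed

section \<open>Averages over independent choices\<close>

text \<open>Expectation for the uniform distribution on a finite set. Probabilities appear as
  averages of \<open>of_bool\<close>, so the probabilistic argument stays within finite
  sums.\<close>

definition avg :: "'a set \<Rightarrow> ('a \<Rightarrow> real) \<Rightarrow> real" where
  "avg A F = (\<Sum>x\<in>A. F x) / real (card A)"

lemma avg_mono: "(\<And>x. x \<in> A \<Longrightarrow> F x \<le> G x) \<Longrightarrow> avg A F \<le> avg A G"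
  unfolding avg_def by (intro divide_right_mono sum_mono) auto

lemma avg_add: "avg A (\<lambda>x. F x + G x) = avg A F + avg A G"
  unfolding avg_def by (simp add: sum.distrib add_divide_distrib)

lemma avg_cmult: "avg A (\<lambda>x. c * F x) = c * avg A F"
  unfolding avg_def by (simp add: sum_distrib_left)

lemma avg_sum: "avg A (\<lambda>x. \<Sum>i\<in>I. F i x) = (\<Sum>i\<in>I. avg A (F i))"
  unfolding avg_def by (subst sum.swap) (simp add: sum_divide_distrib)

lemma real_card_Collect_eq_sum:
  "finite I \<Longrightarrow> real (card {i \<in> I. P i}) = (\<Sum>i\<in>I. of_bool (P i))"
  by (simp add: Int_def)

lemma exists_le_avg:
  assumes "finite A" "A \<noteq> {}"
  shows "\<exists>x\<in>A. F x \<le> avg A F"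
proof (rule ccontr)
  assume "\<not> ?thesis"
  then have "(\<Sum>x\<in>A. avg A F) < (\<Sum>x\<in>A. F x)"
    using assms by (intro sum_strict_mono) auto
  then show False using assms by (simp add: avg_def)
qed

text \<open>Independence of the coordinates: both the sum of products over
  \<open>I \<rightarrow>\<^sub>E X\<close> and the cardinality of this set factor over I.\<close>

lemma avg_prod_PiE:
  assumes "finite I" "finite X"
  shows "avg (I \<rightarrow>\<^sub>E X) (\<lambda>g. \<Prod>i\<in>I. h i (g i)) = (\<Prod>i\<in>I. avg X (h i))"
  unfolding avg_def using assms by (simp add: prod_sum_PiE prod_dividef card_PiE)

lemma avg_PiE_all_in:
  assumes "finite I" "finite X" "X \<noteq> {}" "J \<subseteq> I" "Q \<subseteq> X"
  shows "avg (I \<rightarrow>\<^sub>E X) (\<lambda>g. of_bool (\<forall>i\<in>J. g i \<in> Q)) = (real (card Q) / real (card X)) ^ card J"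
proof -
  have "of_bool (\<forall>i\<in>J. g i \<in> Q) = (\<Prod>i\<in>I. if i \<in> J then of_bool (g i \<in> Q) else (1::real))" for g
  proof -
    have "(\<Prod>i\<in>I. if i \<in> J then of_bool (g i \<in> Q) else (1::real)) = (\<Prod>i\<in>J. of_bool (g i \<in> Q))"
      using assms(1,4) by (simp add: prod.If_cases Int_absorb1 Int_commute)
    also have "\<dots> = of_bool (\<forall>i\<in>J. g i \<in> Q)"
      using finite_subset[OF assms(4,1)] by (induction J rule: finite_induct) auto
    finally show ?thesis by simp
  qed
  then have "avg (I \<rightarrow>\<^sub>E X) (\<lambda>g. of_bool (\<forall>i\<in>J. g i \<in> Q))
      = avg (I \<rightarrow>\<^sub>E X) (\<lambda>g. \<Prod>i\<in>I. (\<lambda>i y. if i \<in> J then of_bool (y \<in> Q) else 1) i (g i))"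
    by simp
  also have "\<dots> = (\<Prod>i\<in>I. avg X (\<lambda>y. if i \<in> J then of_bool (y \<in> Q) else 1))"
    by (subst avg_prod_PiE) (use assms in auto)
  also have "\<dots> = (\<Prod>i\<in>I. if i \<in> J then real (card Q) / real (card X) else 1)"
    using assms by (intro prod.cong) (auto simp: avg_def Int_absorb1)
  also have "\<dots> = (real (card Q) / real (card X)) ^ card J"
    using assms(1,4) by (simp add: prod.If_cases Int_absorb1 Int_commute)
  finally show ?thesis .
qed

section \<open>Exponential moments\<close>

text \<open>The exponential moment is taken at parameter \<delta> itself. Since exp \<delta> - 1 <=
  \<delta> + \<delta>^2, the exponent per index is p(\<delta> + \<delta>^2) - \<delta>(p + \<delta>)
  = (p - 1) \<delta>^2, and p <= 1/2 turns this into at most -\<delta>^2 / 2.\<close>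

lemma chernoff_PiE:
  fixes p \<delta> :: real
  assumes fin: "finite I" "finite X" and ne: "X \<noteq> {}" and Q: "Q \<subseteq> X"
    and cQ: "real (card Q) \<le> p * real (card X)" and p: "p \<le> 1/2" and d: "0 < \<delta>" "\<delta> \<le> 1"
  shows "avg (I \<rightarrow>\<^sub>E X) (\<lambda>g. of_bool (real (card I) * (p + \<delta>) < real (card {i \<in> I. g i \<in> Q})))
           \<le> exp (- (real (card I) * \<delta>\<^sup>2 / 2))"
proof -
  let ?m = "real (card I)"
  have cX: "0 < real (card X)" using fin ne by (simp add: card_gt_0_iff)
  have exp_prod: "exp (\<delta> * real (card {i \<in> I. g i \<in> Q})) = (\<Prod>i\<in>I. exp (\<delta> * of_bool (g i \<in> Q)))" for g
  proof -
    have "real (card {i \<in> I. g i \<in> Q}) = (\<Sum>i\<in>I. of_bool (g i \<in> Q))"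
      using fin(1) by (rule real_card_Collect_eq_sum)
    then show ?thesis by (simp only: sum_distrib_left exp_sum[OF fin(1)])
  qed
  have factor: "avg X (\<lambda>y. exp (\<delta> * of_bool (y \<in> Q))) \<le> exp (p * (\<delta> + \<delta>\<^sup>2))"
  proof -
    have "exp (\<delta> * of_bool (y \<in> Q)) = 1 + (exp \<delta> - 1) * of_bool (y \<in> Q)" for y by simp
    then have "avg X (\<lambda>y. exp (\<delta> * of_bool (y \<in> Q))) = avg X (\<lambda>y. 1 + (exp \<delta> - 1) * of_bool (y \<in> Q))"
      by presburger
    also have "\<dots> = 1 + (exp \<delta> - 1) * (real (card Q) / real (card X))"
      using fin Q cX ne by (simp add: avg_add avg_cmult) (simp add: avg_def Int_absorb1)
    also have "\<dots> \<le> 1 + (\<delta> + \<delta>\<^sup>2) * p"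
    proof -
      have "exp \<delta> - 1 \<le> \<delta> + \<delta>\<^sup>2" using exp_bound[of \<delta>] d by simp
      moreover have "real (card Q) / real (card X) \<le> p" using cQ cX by (simp add: field_simps)
      ultimately show ?thesis using d by (intro add_left_mono mult_mono) auto
    qed
    also have "\<dots> \<le> exp (p * (\<delta> + \<delta>\<^sup>2))" by (simp add: mult.commute)
    finally show ?thesis .
  qed
  have pos: "0 \<le> avg X (\<lambda>y. exp (\<delta> * of_bool (y \<in> Q)))"
    unfolding avg_def by (simp add: sum_nonneg)
  \<comment> \<open>Markov's inequality in pointwise form: on the event, the exponential on the
    right is at least 1.\<close>
  have "avg (I \<rightarrow>\<^sub>E X) (\<lambda>g. of_bool (?m * (p + \<delta>) < real (card {i \<in> I. g i \<in> Q})))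
     \<le> avg (I \<rightarrow>\<^sub>E X) (\<lambda>g. exp (- (\<delta> * (?m * (p + \<delta>)))) * exp (\<delta> * real (card {i \<in> I. g i \<in> Q})))"
    using d by (intro avg_mono) (auto simp: of_bool_def simp flip: exp_add)
  also have "\<dots> = exp (- (\<delta> * (?m * (p + \<delta>)))) * (\<Prod>i\<in>I. avg X (\<lambda>y. exp (\<delta> * of_bool (y \<in> Q))))"
    unfolding exp_prod avg_cmult
    using avg_prod_PiE[OF fin, of "\<lambda>_ y. exp (\<delta> * of_bool (y \<in> Q))"] by simp
  also have "\<dots> \<le> exp (- (\<delta> * (?m * (p + \<delta>)))) * exp (p * (\<delta> + \<delta>\<^sup>2)) ^ card I"
    using power_mono[OF factor pos, of "card I"] by simp
  also have "\<dots> = exp (?m * (p * \<delta>\<^sup>2 - \<delta>\<^sup>2))"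
    by (simp add: algebra_simps power2_eq_square flip: exp_of_nat_mult exp_add)
  also have "\<dots> \<le> exp (- (?m * \<delta>\<^sup>2 / 2))"
  proof -
    have "p * \<delta>\<^sup>2 \<le> 1/2 * \<delta>\<^sup>2" using p by (intro mult_right_mono) auto
    then have "?m * (p * \<delta>\<^sup>2 - \<delta>\<^sup>2) \<le> ?m * (- (\<delta>\<^sup>2 / 2))" by (intro mult_left_mono) auto
    then show ?thesis by simp
  qed
  finally show ?thesis .
qed

text \<open>A loop counts twice. The value therefore bounds the number of arcs at v from above and
  is a sum of independent contributions from the two coordinates.\<close>

definition incidences :: "'i set \<Rightarrow> ('i \<Rightarrow> 'a \<times> 'a) \<Rightarrow> 'a \<Rightarrow> real" where
  "incidences I g v = (\<Sum>i\<in>I. of_bool (fst (g i) = v) + of_bool (snd (g i) = v))"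

text \<open>The weight \<open>incidences I g v\<close> is kept next to the indicator because the
  quantity of interest is the number of arcs lost at high vertices. The mean is 2d and the
  exponential moment at most exp(4d), so the cutoff 8d gives 8d exp(-8d) exp(4d) = 8d / exp(4d), and
  exp(4d) >= 1 + 4d.\<close>

lemma avg_large_incidences_le:
  assumes fin: "finite I" "finite V" and v: "v \<in> V" and d: "1 \<le> d"
    and cI: "card I = d * card V"
  shows "avg (I \<rightarrow>\<^sub>E V \<times> V)
     (\<lambda>g. incidences I g v * of_bool (8 * real d < incidences I g v)) \<le> 2"
proof -
  let ?n = "real (card V)" and ?a = "8 * real d"
  have n: "0 < ?n" using fin v by (auto simp: card_gt_0_iff)
  \<comment> \<open>For a >= 1 and x > a: x = a + (x - a) <= a (1 + (x - a)) <= a exp(x -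
    a).\<close>
  have tail: "x * of_bool (?a < x) \<le> ?a * exp (- ?a) * exp x" for x :: real
  proof (cases "?a < x")
    case True
    have "1 \<le> ?a" using d by simp
    have "x = ?a + 1 * (x - ?a)" by simp
    also have "\<dots> \<le> ?a + ?a * (x - ?a)"
      by (intro add_left_mono mult_right_mono) (use True \<open>1 \<le> ?a\<close> in auto)
    also have "\<dots> = ?a * (1 + (x - ?a))" by (simp add: algebra_simps)
    also have "\<dots> \<le> ?a * exp (x - ?a)" using d by (intro mult_left_mono exp_ge_add_one_self) auto
    finally show ?thesis using True by (simp add: exp_diff exp_minus field_simps)
  qed simp
  have mgf: "avg (I \<rightarrow>\<^sub>E V \<times> V) (\<lambda>g. exp (incidences I g v)) \<le> exp (4 * real d)"
  proof -
    have "exp (incidences I g v)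
        = (\<Prod>i\<in>I. (\<lambda>y. exp (of_bool (fst y = v)) * exp (of_bool (snd y = v))) (g i))" for g
      unfolding incidences_def using fin(1) by (simp add: exp_sum exp_add)
    then have "avg (I \<rightarrow>\<^sub>E V \<times> V) (\<lambda>g. exp (incidences I g v))
        = (avg (V \<times> V) (\<lambda>y. exp (of_bool (fst y = v)) * exp (of_bool (snd y = v)))) ^ card I"
      using avg_prod_PiE[OF fin(1), of "V \<times> V" "\<lambda>_ y. exp (of_bool (fst y = v)) * exp (of_bool (snd y = v))"]
        fin(2) by simp
    also have "avg (V \<times> V) (\<lambda>y. exp (of_bool (fst y = v)) * exp (of_bool (snd y = v)))
        = ((\<Sum>x\<in>V. exp (of_bool (x = v))) / ?n)\<^sup>2"
      unfolding avg_def
      by (simp add: sum_product sum.cartesian_product card_cartesian_product power2_eq_square case_prod_beta)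
    also have "(\<Sum>x\<in>V. exp (of_bool (x = v)) :: real) = (\<Sum>x\<in>V. 1 + (if x = v then exp 1 - 1 else 0))"
      by (intro sum.cong) auto
    also have "\<dots> = ?n + (exp 1 - 1)" using fin v by (simp add: sum.distrib)
    also have "((?n + (exp 1 - 1)) / ?n)\<^sup>2 \<le> (exp (2 / ?n))\<^sup>2"
    proof (rule power_mono)
      have "(?n + (exp 1 - 1)) / ?n = 1 + (exp 1 - 1) / ?n" using n by (simp add: field_simps)
      also have "\<dots> \<le> 1 + 2 / ?n" using exp_le n by (intro add_left_mono divide_right_mono) auto
      also have "\<dots> \<le> exp (2 / ?n)" by (rule exp_ge_add_one_self)
      finally show "(?n + (exp 1 - 1)) / ?n \<le> exp (2 / ?n)" .
      show "0 \<le> (?n + (exp 1 - 1)) / ?n" using n by simp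
    qed
    then have "(((?n + (exp 1 - 1)) / ?n)\<^sup>2) ^ card I \<le> ((exp (2 / ?n))\<^sup>2) ^ card I"
      by (intro power_mono) auto
    also have "((exp (2 / ?n))\<^sup>2) ^ card I = exp (4 * real d)"
      using n cI by (simp flip: exp_of_nat_mult power_mult)
    finally show ?thesis .
  qed
  have "avg (I \<rightarrow>\<^sub>E V \<times> V) (\<lambda>g. incidences I g v * of_bool (?a < incidences I g v))
      \<le> avg (I \<rightarrow>\<^sub>E V \<times> V) (\<lambda>g. ?a * exp (- ?a) * exp (incidences I g v))"
    by (intro avg_mono tail)
  also have "\<dots> \<le> ?a * exp (- ?a) * exp (4 * real d)"
    unfolding avg_cmult using mgf by (intro mult_left_mono) auto
  also have "\<dots> = 8 * real d / exp (4 * real d)"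
    by (simp add: exp_minus field_simps flip: exp_add)
  also have "\<dots> \<le> 2"
    unfolding pos_divide_le_eq[OF exp_gt_zero] using exp_ge_add_one_self[of "4 * real d"] by linarith
  finally show ?thesis .
qed

section \<open>Counting dense index sets and increasing pairs\<close>

text \<open>A single term of the exponential series. It plays the part of Stirling's formula when
  binomial coefficients are estimated.\<close>

lemma power_over_fact_le_exp:
  fixes x :: real
  assumes "0 \<le> x"
  shows "x ^ j / fact j \<le> exp x"
proof -
  have "(\<Sum>i\<in>{j}. x ^ i / fact i) \<le> (\<Sum>i. x ^ i / fact i)"
    using assms summable_exp_generic[of x]
    by (intro sum_le_suminf) (auto simp: divide_inverse mult.commute scaleR_conv_of_real)
  then show ?thesis by (simp add: exp_def divide_inverse mult.commute scaleR_conv_of_real)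
qed

lemma binomial_le_power_over_fact: "real (n choose s) \<le> real n ^ s / fact s"
proof -
  have "real ((n choose s) * fact s) \<le> real (n ^ s)" using binomial_fact_pow by (rule of_nat_mono)
  then show ?thesis by (simp add: field_simps)
qed

text \<open>Union bound over the vertex set S and the index set J, with probability (s/n)^(2(s+x))
  for each pair. The choices contribute n^s and (dn)^(s+x), so the powers of n cancel down to
  n^(-x). For x = 0 the bound no longer depends on n.\<close>

lemma expected_dense_pairs_le:
  assumes fin: "finite I" "finite V" and n: "V \<noteq> {}"
    and cI: "card I = d * card V"
  shows "(\<Sum>S | S \<subseteq> V \<and> card S = s. \<Sum>J | J \<subseteq> I \<and> card J = s + x.
            avg (I \<rightarrow>\<^sub>E V \<times> V) (\<lambda>g. of_bool (\<forall>i\<in>J. g i \<in> S \<times> S)))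
     \<le> exp (2 * real s) * real d ^ (s + x) * (real s / real (card V)) ^ x"
proof -
  let ?n = "real (card V)" and ?s = "real s"
  have n0: "0 < ?n" using fin n by (simp add: card_gt_0_iff)
  have ev: "avg (I \<rightarrow>\<^sub>E V \<times> V) (\<lambda>g. of_bool (\<forall>i\<in>J. g i \<in> S \<times> S)) = ((?s / ?n)\<^sup>2) ^ (s + x)"
    if "S \<subseteq> V" "card S = s" "J \<subseteq> I" "card J = s + x" for S J
    using that fin n
    by (subst avg_PiE_all_in) (auto simp: card_cartesian_product power2_eq_square)
  have "(\<Sum>S | S \<subseteq> V \<and> card S = s. \<Sum>J | J \<subseteq> I \<and> card J = s + x.
            avg (I \<rightarrow>\<^sub>E V \<times> V) (\<lambda>g. of_bool (\<forall>i\<in>J. g i \<in> S \<times> S)))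
      = (\<Sum>S | S \<subseteq> V \<and> card S = s. \<Sum>J | J \<subseteq> I \<and> card J = s + x. ((?s / ?n)\<^sup>2) ^ (s + x))"
    by (intro sum.cong refl) (simp add: ev)
  also have "\<dots> = real (card V choose s) * (real (card I choose (s + x)) * ((?s / ?n)\<^sup>2) ^ (s + x))"
    using fin by (simp add: n_subsets)
  also have "\<dots> \<le> (?n ^ s / fact s) * ((real (card I) ^ (s + x) / fact (s + x)) * ((?s / ?n)\<^sup>2) ^ (s + x))"
    by (intro mult_mono binomial_le_power_over_fact mult_right_mono) auto
  \<comment> \<open>The powers of s are split as s^s, s^(s+x) and s^x, so that each factorial meets
    a power of matching exponent and costs at most exp s.\<close>
  also have "\<dots> = (?s ^ s / fact s) * (?s ^ (s + x) / fact (s + x)) * (real d ^ (s + x) * (?s / ?n) ^ x)"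
    using n0 by (simp add: cI power_add power_mult_distrib power_divide power2_eq_square field_simps)
  also have "\<dots> \<le> exp ?s * exp ?s * (real d ^ (s + x) * (?s / ?n) ^ x)"
    using n0 by (intro mult_right_mono mult_mono power_over_fact_le_exp) auto
  also have "\<dots> = exp (2 * ?s) * real d ^ (s + x) * (?s / ?n) ^ x"
    by (simp flip: exp_add)
  finally show ?thesis .
qed

text \<open>Swapping coordinates shows that increasing and decreasing pairs are equally many. By
  Cauchy-Schwarz on the k class sizes at least a fraction 1/k of all pairs are ties; the diagonal
  pairs are among these ties, which makes the bound free of lower-order terms.\<close>

lemma card_increasing_pairs_le:
  fixes f :: "'a \<Rightarrow> nat"
  assumes fin: "finite V" and f: "f \<in> V \<rightarrow> {1..k}" and k: "1 \<le> k"
  shows "real (card {y \<in> V \<times> V. f (fst y) < f (snd y)})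
     \<le> 1/2 * (1 - 1 / real k) * real (card (V \<times> V))"
proof -
  let ?L = "{y \<in> V \<times> V. f (fst y) < f (snd y)}" and ?G = "{y \<in> V \<times> V. f (fst y) > f (snd y)}"
    and ?E = "{y \<in> V \<times> V. f (fst y) = f (snd y)}"
  have finVV: "finite (V \<times> V)" using fin by simp
  have "V \<times> V = ?L \<union> (?G \<union> ?E)" by auto
  also have "card \<dots> = card ?L + card (?G \<union> ?E)"
    by (rule card_Un_disjoint) (use finVV in \<open>auto intro: finite_subset[OF _ finVV]\<close>)
  also have "card (?G \<union> ?E) = card ?G + card ?E"
    by (rule card_Un_disjoint) (use finVV in \<open>auto intro: finite_subset[OF _ finVV]\<close>)
  finally have total: "card (V \<times> V) = card ?L + (card ?G + card ?E)" .
  have "bij_betw prod.swap ?L ?G" by (rule bij_betwI[where g = prod.swap]) auto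
  then have LG: "card ?L = card ?G" by (rule bij_betw_same_card)
  define c where "c a = real (card {v \<in> V. f v = a})" for a
  have "?E = (\<Union>a\<in>{1..k}. {v \<in> V. f v = a} \<times> {v \<in> V. f v = a})" using f by auto
  also have "card \<dots> = (\<Sum>a\<in>{1..k}. card ({v \<in> V. f v = a} \<times> {v \<in> V. f v = a}))"
    by (rule card_UN_disjoint) (use fin in auto)
  finally have E: "real (card ?E) = (\<Sum>a\<in>{1..k}. (c a)\<^sup>2)"
    by (simp add: card_cartesian_product power2_eq_square c_def)
  have "V = (\<Union>a\<in>{1..k}. {v \<in> V. f v = a})" using f by auto
  then have "card V = card (\<Union>a\<in>{1..k}. {v \<in> V. f v = a})" by simp
  also have "\<dots> = (\<Sum>a\<in>{1..k}. card {v \<in> V. f v = a})"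
    by (rule card_UN_disjoint) (use fin in auto)
  finally have "real (card V) = (\<Sum>a\<in>{1..k}. c a)" unfolding c_def by simp
  then have "(real (card V))\<^sup>2 \<le> real (card ?E) * real k"
    using sum_squared_le_sum_of_squares[of c "{1..k}"] E by simp
  then have "real (card (V \<times> V)) / real k \<le> real (card ?E)"
    using k by (simp add: card_cartesian_product power2_eq_square field_simps)
  moreover have "real (card (V \<times> V)) = 2 * real (card ?L) + real (card ?E)" using total LG by linarith
  ultimately show ?thesis by (simp add: algebra_simps add_divide_distrib)
qed

section \<open>First-moment estimates\<close>

text \<open>With deviation \<epsilon>/2 the Chernoff exponent is dn \<epsilon>^2 / 8, and the factor
  16 in the hypothesis makes it at least 2 n ln k. Half of that pays for the k^n labellings; the
  rest gives exp(-n ln k) <= exp(-2 ln 2) = 1/4.\<close>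

lemma avg_bad_labellings_le:
  fixes \<epsilon> :: real
  assumes k: "2 \<le> k" and n: "2 \<le> n" and e: "0 < \<epsilon>" "\<epsilon> \<le> 1/2" and d: "16 * ln (real k) \<le> real d * \<epsilon>\<^sup>2"
  shows "avg ({..<d * n} \<rightarrow>\<^sub>E {..<n} \<times> {..<n}) (\<lambda>g. \<Sum>f\<in>{..<n} \<rightarrow>\<^sub>E {1..k}.
      of_bool (real (d * n) * (1/2 * (1 - 1 / real k) + \<epsilon> / 2)
        < real (card {i \<in> {..<d * n}. f (fst (g i)) < f (snd (g i))}))) \<le> 1/4"
proof -
  let ?V = "{..<n}" and ?I = "{..<d * n}" and ?p = "1/2 * (1 - 1 / real k)"
  let ?bad = "\<lambda>f g. of_bool (real (d * n) * (?p + \<epsilon> / 2)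
      < real (card {i \<in> ?I. f (fst (g i)) < f (snd (g i))})) :: real"
  have one: "avg (?I \<rightarrow>\<^sub>E ?V \<times> ?V) (?bad f) \<le> exp (- (2 * real n * ln (real k)))"
    if f: "f \<in> ?V \<rightarrow>\<^sub>E {1..k}" for f
  proof -
    let ?Q = "{y \<in> ?V \<times> ?V. f (fst y) < f (snd y)}"
    have "avg (?I \<rightarrow>\<^sub>E ?V \<times> ?V) (?bad f)
        = avg (?I \<rightarrow>\<^sub>E ?V \<times> ?V) (\<lambda>g. of_bool (real (card ?I) * (?p + \<epsilon> / 2) < real (card {i \<in> ?I. g i \<in> ?Q})))"
      unfolding avg_def
    proof (intro arg_cong2[of _ _ _ _ "(/)"] sum.cong refl)
      fix g assume "g \<in> ?I \<rightarrow>\<^sub>E ?V \<times> ?V"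
      then have "{i \<in> ?I. g i \<in> ?Q} = {i \<in> ?I. f (fst (g i)) < f (snd (g i))}" by auto
      then show "?bad f g = of_bool (real (card ?I) * (?p + \<epsilon> / 2) < real (card {i \<in> ?I. g i \<in> ?Q}))"
        by simp
    qed
    also have "\<dots> \<le> exp (- (real (card ?I) * (\<epsilon> / 2)\<^sup>2 / 2))"
    proof (rule chernoff_PiE)
      show "real (card ?Q) \<le> ?p * real (card (?V \<times> ?V))"
        by (rule card_increasing_pairs_le) (use f k in auto)
      show "?V \<times> ?V \<noteq> {}" using n by (auto simp: lessThan_empty_iff)
    qed (use e in auto)
    also have "\<dots> \<le> exp (- (2 * real n * ln (real k)))"
      using mult_left_mono[OF d, of "real n"] by (simp add: power2_eq_square algebra_simps)
    finally show ?thesis .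
  qed
  have "avg (?I \<rightarrow>\<^sub>E ?V \<times> ?V) (\<lambda>g. \<Sum>f\<in>?V \<rightarrow>\<^sub>E {1..k}. ?bad f g)
      = (\<Sum>f\<in>?V \<rightarrow>\<^sub>E {1..k}. avg (?I \<rightarrow>\<^sub>E ?V \<times> ?V) (?bad f))"
    by (rule avg_sum)
  also have "\<dots> \<le> real (card (?V \<rightarrow>\<^sub>E {1..k})) * exp (- (2 * real n * ln (real k)))"
    using sum_bounded_above[OF one] by simp
  also have "real (card (?V \<rightarrow>\<^sub>E {1..k})) = exp (real n * ln (real k))"
    using k by (simp add: card_PiE exp_of_nat_mult)
  also have "exp (real n * ln (real k)) * exp (- (2 * real n * ln (real k))) = exp (- (real n * ln (real k)))"
    by (simp flip: exp_add)
  also have "\<dots> \<le> exp (- (2 * ln 2))"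
    using k n mult_mono[of 2 "real n" "ln 2" "ln (real k)"] by simp
  also have "\<dots> = 1/4"
    using exp_of_nat_mult[of 2 "ln (2::real)"] by (simp add: exp_minus field_simps)
  finally show ?thesis .
qed

lemma exp_2_mult_le: "exp (2 * real s) \<le> 9 ^ s"
proof -
  have "exp 1 ^ 2 \<le> (3::real) ^ 2" by (intro power_mono exp_le) auto
  then have "(exp 2 :: real) \<le> 9" by (simp flip: exp_of_nat_mult)
  then have "exp 2 ^ s \<le> (9::real) ^ s" by (intro power_mono) auto
  then show ?thesis by (simp add: mult.commute flip: exp_of_nat_mult)
qed

text \<open>Turns the constant 9 from exp 2 <= 9 into powers of 4d, so that estimates can be
  compared with powers of (4d)^l alone.\<close>

lemma nine_power_le_four_power:
  fixes d :: nat
  assumes "1 \<le> d"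
  shows "(9 * real d) ^ j \<le> (4 * real d) ^ (2 * j)"
proof -
  have "9 * real d \<le> (4 * real d)\<^sup>2"
    using assms mult_left_mono[of 1 "real d" "16 * real d"] by (simp add: power2_eq_square)
  then show ?thesis unfolding power_mult by (intro power_mono) auto
qed

text \<open>Since s + x <= (6l+3) x, the whole bound is at most the x-th power of one quantity
  \<open>?q\<close>, and it suffices to make \<open>?q\<close> small. The target carries M^4, with M
  = (4d)^l, because the bound will be summed over M^4 values of s.\<close>

lemma dense_pairs_bound_le:
  fixes d l n s x :: nat
  assumes d: "1 \<le> d" and l: "1 \<le> l" and n: "((4 * d) ^ l) ^ 100 \<le> n"
    and s: "s \<le> ((4 * d) ^ l) ^ 4" "s \<le> x * (6 * l + 2)" and x: "1 \<le> x"
  shows "exp (2 * real s) * real d ^ (s + x) * (real s / real n) ^ x \<le> 1 / (4 * real ((4 * d) ^ l) ^ 4)"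
proof -
  define M where "M = real ((4 * d) ^ l)"
  have M4: "4 \<le> M"
  proof -
    have "4 * d \<le> (4 * d) ^ l" using d l by (intro self_le_power) auto
    then have "4 \<le> (4 * d) ^ l" using d by linarith
    then show ?thesis unfolding M_def using of_nat_mono by fastforce
  qed
  have nM: "M ^ 100 \<le> real n" unfolding M_def using n by (metis of_nat_le_iff of_nat_power)
  moreover have "0 < M ^ 100" using M4 by simp
  ultimately have n0: "0 < real n" by linarith
  have sM: "real s \<le> M ^ 4" unfolding M_def using s(1) by (metis of_nat_le_iff of_nat_power)
  let ?q = "(9 * real d) ^ (6 * l + 3) * (real s / real n)"
  have "(9 * real d) ^ (6 * l + 3) \<le> (4 * real d) ^ (2 * (6 * l + 3))" using d by (rule nine_power_le_four_power)
  \<comment> \<open>2(6l+3) = 12l + 6 <= 18l because l >= 1.\<close>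
  also have "\<dots> \<le> (4 * real d) ^ (l * 18)" using d l by (intro power_increasing) auto
  also have "\<dots> = M ^ 18" unfolding M_def by (simp add: power_mult)
  finally have q: "?q \<le> M ^ 18 * (M ^ 4 / M ^ 100)"
    using sM nM M4 n0 by (intro mult_mono frac_le) auto
  also have "\<dots> = M ^ 22 / M ^ 100" by (simp flip: power_add)
  \<comment> \<open>Only five of the spare powers are used: M^4 for the target and one more M >= 4
    for the factor 4.\<close>
  also have "\<dots> \<le> M ^ 22 / M ^ 27"
    using M4 by (intro divide_left_mono power_increasing mult_pos_pos) auto
  also have "\<dots> = 1 / (M * M ^ 4)" using M4 by (simp add: field_simps flip: power_add power_Suc)
  also have "\<dots> \<le> 1 / (4 * M ^ 4)" using M4 by (intro divide_left_mono mult_right_mono mult_pos_pos) auto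
  finally have q': "?q \<le> 1 / (4 * M ^ 4)" .
  have "1 \<le> M ^ 4" using M4 by (intro one_le_power) simp
  then have "1 \<le> 4 * M ^ 4" by linarith
  then have "1 / (4 * M ^ 4) \<le> 1 / 1" by (intro frac_le) auto
  then have q1: "?q \<le> 1" using q' unfolding div_by_1 by (rule order_trans[rotated])
  have "exp (2 * real s) * real d ^ (s + x) * (real s / real n) ^ x
      \<le> 9 ^ (s + x) * real d ^ (s + x) * (real s / real n) ^ x"
  proof (intro mult_right_mono)
    have "(9::real) ^ s \<le> 9 ^ (s + x)" by (intro power_increasing) auto
    then show "exp (2 * real s) \<le> 9 ^ (s + x)" using exp_2_mult_le[of s] by linarith
  qed auto
  also have "\<dots> = (9 * real d) ^ (s + x) * (real s / real n) ^ x" by (simp add: power_mult_distrib)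
  also have "\<dots> \<le> (9 * real d) ^ ((6 * l + 3) * x) * (real s / real n) ^ x"
    using s(2) d by (intro mult_right_mono power_increasing) (auto simp: algebra_simps)
  also have "\<dots> = ?q ^ x" by (simp only: power_mult power_mult_distrib)
  also have "\<dots> \<le> ?q ^ 1" using q1 x by (intro power_decreasing) auto
  finally show ?thesis using q' unfolding M_def by simp
qed

text \<open>Formulated for index sets instead of arc sets, so that repeated draws of one arc are
  counted separately.\<close>

definition confined :: "('i \<Rightarrow> 'a \<times> 'a) \<Rightarrow> 'a set \<Rightarrow> 'i set \<Rightarrow> bool" where
  "confined g S J \<longleftrightarrow> (\<forall>i\<in>J. g i \<in> S \<times> S)"

text \<open>The quotient is s / (6l+2) rounded up, the least excess x with s <= x(6l+2). A set with
  larger excess contains an index set with this one, so one value of x per s is enough.\<close>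

lemma avg_dense_pairs_le:
  fixes d l n :: nat
  assumes d: "1 \<le> d" and l: "1 \<le> l" and n: "((4 * d) ^ l) ^ 100 \<le> n"
  shows "avg ({..<d * n} \<rightarrow>\<^sub>E {..<n} \<times> {..<n})
     (\<lambda>g. \<Sum>s\<in>{1..((4 * d) ^ l) ^ 4}. \<Sum>S | S \<subseteq> {..<n} \<and> card S = s.
       \<Sum>J | J \<subseteq> {..<d * n} \<and> card J = s + (s + (6 * l + 1)) div (6 * l + 2).
         of_bool (confined g S J)) \<le> 1/4"
proof -
  let ?M4 = "((4 * d) ^ l) ^ 4" and ?x = "\<lambda>s. (s + (6 * l + 1)) div (6 * l + 2)"
  have M0: "0 < real ?M4" using d by simp
  have "0 < ((4 * d) ^ l) ^ 100" using d by simp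
  from this n have "0 < n" by (rule less_le_trans)
  then have n0: "{..<n} \<noteq> {}" by (auto simp: lessThan_empty_iff)
  have x1: "1 \<le> ?x s" if "1 \<le> s" for s
    using that div_le_mono[of "6 * l + 2" "s + (6 * l + 1)" "6 * l + 2"] by simp
  have xs: "s \<le> ?x s * (6 * l + 2)" for s
  proof -
    have "s + (6 * l + 1) = ?x s * (6 * l + 2) + (s + (6 * l + 1)) mod (6 * l + 2)"
      by (rule div_mult_mod_eq[symmetric])
    moreover have "(s + (6 * l + 1)) mod (6 * l + 2) < 6 * l + 2" by simp
    ultimately show ?thesis by linarith
  qed
  have one: "(\<Sum>S | S \<subseteq> {..<n} \<and> card S = s. \<Sum>J | J \<subseteq> {..<d * n} \<and> card J = s + ?x s.
         avg ({..<d * n} \<rightarrow>\<^sub>E {..<n} \<times> {..<n}) (\<lambda>g. of_bool (confined g S J))) \<le> 1 / (4 * real ((4 * d) ^ l) ^ 4)"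
    if s: "s \<in> {1..?M4}" for s
    unfolding confined_def
    using expected_dense_pairs_le[of "{..<d * n}" "{..<n}" d s "?x s"] n0 s
      dense_pairs_bound_le[OF d l n, of s "?x s"] x1[of s] xs[of s] by fastforce
  show ?thesis unfolding avg_sum
    by (rule order_trans, rule sum_bounded_above, erule one) (use M0 in simp)
qed

lemma avg_large_incidences_sum_le:
  assumes d: "1 \<le> d"
  shows "avg ({..<d * n} \<rightarrow>\<^sub>E {..<n} \<times> {..<n})
     (\<lambda>g. \<Sum>v\<in>{..<n}. incidences {..<d * n} g v * of_bool (8 * real d < incidences {..<d * n} g v))
     \<le> 2 * real n"
proof -
  have one: "avg ({..<d * n} \<rightarrow>\<^sub>E {..<n} \<times> {..<n})
     (\<lambda>g. incidences {..<d * n} g v * of_bool (8 * real d < incidences {..<d * n} g v)) \<le> 2"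
    if "v \<in> {..<n}" for v
    by (rule avg_large_incidences_le) (use that d in auto)
  show ?thesis unfolding avg_sum
    by (rule order_trans, rule sum_bounded_above, erule one) simp
qed

lemma odd_le_4_power: "2 * l + 1 \<le> (4::nat) ^ l"
  by (induction l) simp_all

text \<open>The weight s is the number of indices lost with one such J. With M = (4d)^l, the number
  of sizes and the weight are each at most 2l+1 <= M, and (9d)^(2l+1) <= (4d)^(4l+2) <= M^6.\<close>

lemma avg_short_cycles_le:
  fixes d l n :: nat
  assumes d: "1 \<le> d" and l: "1 \<le> l" and n: "0 < n"
  shows "avg ({..<d * n} \<rightarrow>\<^sub>E {..<n} \<times> {..<n})
     (\<lambda>g. \<Sum>s\<in>{1..2 * l + 1}. \<Sum>S | S \<subseteq> {..<n} \<and> card S = s.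
       \<Sum>J | J \<subseteq> {..<d * n} \<and> card J = s. real s * of_bool (confined g S J))
     \<le> real ((4 * d) ^ l) ^ 8"
proof -
  let ?r = "2 * l + 1" and ?M = "real ((4 * d) ^ l)"
  have n0: "{..<n} \<noteq> {}" using n by (auto simp: lessThan_empty_iff)
  have one: "(\<Sum>S | S \<subseteq> {..<n} \<and> card S = s. \<Sum>J | J \<subseteq> {..<d * n} \<and> card J = s.
         avg ({..<d * n} \<rightarrow>\<^sub>E {..<n} \<times> {..<n}) (\<lambda>g. real s * of_bool (confined g S J)))
       \<le> real ?r * (9 * real d) ^ ?r"
    if s: "s \<in> {1..?r}" for s
  proof -
    have "(\<Sum>S | S \<subseteq> {..<n} \<and> card S = s. \<Sum>J | J \<subseteq> {..<d * n} \<and> card J = s.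
         avg ({..<d * n} \<rightarrow>\<^sub>E {..<n} \<times> {..<n}) (\<lambda>g. real s * of_bool (confined g S J)))
       = real s * (\<Sum>S | S \<subseteq> {..<n} \<and> card S = s. \<Sum>J | J \<subseteq> {..<d * n} \<and> card J = s.
         avg ({..<d * n} \<rightarrow>\<^sub>E {..<n} \<times> {..<n}) (\<lambda>g. of_bool (\<forall>i\<in>J. g i \<in> S \<times> S)))"
      unfolding avg_cmult confined_def by (simp add: sum_distrib_left)
    also have "\<dots> \<le> real s * (exp (2 * real s) * real d ^ s)"
      using expected_dense_pairs_le[of "{..<d * n}" "{..<n}" d s 0] n0
      by (intro mult_left_mono) auto
    also have "\<dots> \<le> real s * (9 ^ s * real d ^ s)"
      by (intro mult_left_mono mult_right_mono exp_2_mult_le) auto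
    also have "\<dots> = real s * (9 * real d) ^ s" by (simp add: power_mult_distrib)
    also have "\<dots> \<le> real ?r * (9 * real d) ^ ?r"
      using s d by (intro mult_mono power_increasing) auto
    finally show ?thesis .
  qed
  have "avg ({..<d * n} \<rightarrow>\<^sub>E {..<n} \<times> {..<n})
     (\<lambda>g. \<Sum>s\<in>{1..?r}. \<Sum>S | S \<subseteq> {..<n} \<and> card S = s.
       \<Sum>J | J \<subseteq> {..<d * n} \<and> card J = s. real s * of_bool (confined g S J))
     \<le> real ?r * (real ?r * (9 * real d) ^ ?r)"
    unfolding avg_sum by (rule order_trans, rule sum_bounded_above, erule one) simp
  also have "\<dots> \<le> ?M * (?M * ?M ^ 6)"
  proof -
    have "?r \<le> 4 ^ l" by (rule odd_le_4_power)
    also have "\<dots> \<le> (4 * d) ^ l" using d by (intro power_mono) auto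
    finally have r: "real ?r \<le> ?M" by (rule of_nat_mono)
    have "(9 * real d) ^ ?r \<le> (4 * real d) ^ (2 * ?r)" using d by (rule nine_power_le_four_power)
    also have "\<dots> \<le> (4 * real d) ^ (l * 6)" using d l by (intro power_increasing) auto
    also have "\<dots> = ?M ^ 6" by (simp add: power_mult)
    finally show ?thesis using r by (intro mult_mono) auto
  qed
  also have "\<dots> = ?M ^ 8" by (simp add: power_Suc[symmetric] del: power_Suc of_nat_power)
  finally show ?thesis .
qed

text \<open>The bad events and the deletion cost, the latter scaled so that 1 is the allowed amount,
  are added into one nonnegative quantity of average at most 1/4 + 1/4 + 3/10 < 1. Some g makes the
  sum less than 1, hence every summand; for the two counting sums this means that no bad labelling
  and no dense set is present.\<close>

lemma exists_good_assignment:
  fixes d l n k :: nat and \<epsilon> :: real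
  defines "V \<equiv> {..<n}" and "I \<equiv> {..<d * n}"
  assumes k: "2 \<le> k" and e: "0 < \<epsilon>" "\<epsilon> \<le> 1/2" and dk: "16 * ln (real k) \<le> real d * \<epsilon>\<^sup>2"
    and l: "1 \<le> l" and n: "((4 * d) ^ l) ^ 100 \<le> n"
  shows "\<exists>g \<in> I \<rightarrow>\<^sub>E V \<times> V.
     (\<forall>f \<in> V \<rightarrow>\<^sub>E {1..k}. real (card {i \<in> I. f (fst (g i)) < f (snd (g i))})
        \<le> real (d * n) * (1/2 * (1 - 1 / real k) + \<epsilon> / 2)) \<and>
     (\<forall>S J x. S \<subseteq> V \<and> S \<noteq> {} \<and> card S \<le> ((4 * d) ^ l) ^ 4 \<and> J \<subseteq> I \<and> 1 \<le> x \<and>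
        card J = card S + x \<and> confined g S J \<longrightarrow> x * (6 * l + 2) < card S) \<and>
     (\<Sum>v\<in>V. incidences I g v * of_bool (8 * real d < incidences I g v)) +
       (\<Sum>s\<in>{1..2 * l + 1}. \<Sum>S | S \<subseteq> V \<and> card S = s.
          \<Sum>J | J \<subseteq> I \<and> card J = s. real s * of_bool (confined g S J))
       < \<epsilon> * real (d * n) / 2"
proof -
  let ?\<Omega> = "I \<rightarrow>\<^sub>E V \<times> V" and ?M = "real ((4 * d) ^ l)"
  define r where "r s = (s + (6 * l + 1)) div (6 * l + 2)" for s
  define lim where "lim = real (d * n) * (1/2 * (1 - 1 / real k) + \<epsilon> / 2)"
  define P1 where "P1 g = (\<Sum>f\<in>V \<rightarrow>\<^sub>E {1..k}.
      of_bool (lim < real (card {i \<in> I. f (fst (g i)) < f (snd (g i))})) :: real)" for g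
  define P2 where "P2 g = (\<Sum>s\<in>{1..((4 * d) ^ l) ^ 4}. \<Sum>S | S \<subseteq> V \<and> card S = s.
      \<Sum>J | J \<subseteq> I \<and> card J = s + r s. of_bool (confined g S J) :: real)" for g
  define Y1 where "Y1 g = (\<Sum>v\<in>V. incidences I g v * of_bool (8 * real d < incidences I g v))" for g
  define Y2 where "Y2 g = (\<Sum>s\<in>{1..2 * l + 1}. \<Sum>S | S \<subseteq> V \<and> card S = s.
      \<Sum>J | J \<subseteq> I \<and> card J = s. real s * of_bool (confined g S J))" for g
  have finV: "finite V" and finI: "finite I" unfolding V_def I_def by auto
  have ln2: "2/3 \<le> ln (2::real)" by (rule ln2_ge_two_thirds)
  also have "ln 2 \<le> ln (real k)" using k by simp
  finally have lnk: "2/3 \<le> ln (real k)" .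
  \<comment> \<open>From d \<epsilon>^2 >= 16 * (2/3) and \<epsilon> <= 1/2. The value 20 is chosen
    to turn the scaled deletion cost 6 / (d \<epsilon>) into at most 3/10.\<close>
  have de: "20 \<le> real d * \<epsilon>"
  proof -
    have "16 * (2/3) \<le> (real d * \<epsilon>) * \<epsilon>" using dk lnk by (simp add: power2_eq_square mult.assoc)
    also have "\<dots> \<le> (real d * \<epsilon>) * (1/2)" using e by (intro mult_left_mono) auto
    finally show ?thesis by simp
  qed
  then have d: "1 \<le> d" using e by (cases d) auto
  have M4: "4 \<le> ?M"
  proof -
    have "4 * d \<le> (4 * d) ^ l" using d l by (intro self_le_power) auto
    then have "4 \<le> (4 * d) ^ l" using d by linarith
    then show ?thesis using of_nat_mono by fastforce
  qed
  have nM: "?M ^ 100 \<le> real n" using n by (metis of_nat_le_iff of_nat_power)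
  have "?M ^ 1 \<le> ?M ^ 100" "?M ^ 8 \<le> ?M ^ 100" using M4 by (intro power_increasing; simp)+
  then have M1: "?M ^ 1 \<le> real n" and M8: "?M ^ 8 \<le> real n" using nM by (blast intro: order_trans)+
  from M1 have n4: "4 \<le> real n" using M4 unfolding power_one_right by (rule order_trans[rotated])
  have "avg ?\<Omega> P1 \<le> 1/4" unfolding P1_def lim_def V_def I_def
    by (rule avg_bad_labellings_le) (use k n4 e dk in auto)
  moreover have "avg ?\<Omega> P2 \<le> 1/4" unfolding P2_def r_def V_def I_def
    using avg_dense_pairs_le[OF d l n] .
  moreover have "avg ?\<Omega> (\<lambda>g. 2 / (\<epsilon> * real (d * n)) * (Y1 g + Y2 g)) \<le> 3/10"
  proof -
    have "avg ?\<Omega> Y1 \<le> 2 * real n" unfolding Y1_def V_def I_def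
      using avg_large_incidences_sum_le[OF d] .
    moreover have "avg ?\<Omega> Y2 \<le> ?M ^ 8" unfolding Y2_def V_def I_def
      using avg_short_cycles_le[OF d l] n4 by simp
    ultimately have "avg ?\<Omega> (\<lambda>g. Y1 g + Y2 g) \<le> 3 * real n" using M8 unfolding avg_add by linarith
    then have "2 / (\<epsilon> * real (d * n)) * avg ?\<Omega> (\<lambda>g. Y1 g + Y2 g) \<le> 2 / (\<epsilon> * real (d * n)) * (3 * real n)"
      using e by (intro mult_left_mono) auto
    also have "\<dots> = 6 / (real d * \<epsilon>)" using n4 by simp
    also have "\<dots> \<le> 6 / 20" using de by (intro divide_left_mono) auto
    finally show ?thesis unfolding avg_cmult by simp
  qed
  ultimately have lt1: "avg ?\<Omega> (\<lambda>g. P1 g + (P2 g + 2 / (\<epsilon> * real (d * n)) * (Y1 g + Y2 g))) < 1"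
    unfolding avg_add by linarith
  have fin\<Omega>: "finite ?\<Omega>" using finV finI by (intro finite_PiE) auto
  have ne\<Omega>: "?\<Omega> \<noteq> {}" using n4 unfolding V_def by (auto simp: PiE_eq_empty_iff lessThan_empty_iff)
  obtain g where g: "g \<in> ?\<Omega>"
    and total: "P1 g + (P2 g + 2 / (\<epsilon> * real (d * n)) * (Y1 g + Y2 g)) < 1"
    using exists_le_avg[OF fin\<Omega> ne\<Omega>,
        of "\<lambda>g. P1 g + (P2 g + 2 / (\<epsilon> * real (d * n)) * (Y1 g + Y2 g))"]
    by (elim bexE) (rule that, assumption, erule le_less_trans[OF _ lt1])
  have inc0: "0 \<le> incidences I g v" for v unfolding incidences_def by (simp add: sum_nonneg)
  have pos: "0 \<le> P1 g" "0 \<le> P2 g" "0 \<le> Y1 g + Y2 g"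
    unfolding P1_def P2_def Y1_def Y2_def using inc0 by (auto intro!: sum_nonneg add_nonneg_nonneg)
  have "0 \<le> 2 / (\<epsilon> * real (d * n)) * (Y1 g + Y2 g)" using pos e by simp
  with total pos have lt: "P1 g < 1" "P2 g < 1" "2 / (\<epsilon> * real (d * n)) * (Y1 g + Y2 g) < 1"
    by linarith+
  have "0 < \<epsilon> * real (d * n)" using e d n4 by simp
  then have Y: "Y1 g + Y2 g < \<epsilon> * real (d * n) / 2" using lt(3) by (simp add: field_simps)
  have A: "real (card {i \<in> I. f (fst (g i)) < f (snd (g i))}) \<le> lim" if f: "f \<in> V \<rightarrow>\<^sub>E {1..k}" for f
  proof (rule ccontr)
    assume "\<not> ?thesis"
    then have "1 = of_bool (lim < real (card {i \<in> I. f (fst (g i)) < f (snd (g i))}))" by simp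
    also have "\<dots> \<le> P1 g" unfolding P1_def
      by (rule member_le_sum[OF f]) (use finV in \<open>auto intro: finite_PiE\<close>)
    finally show False using lt(1) by simp
  qed
  have B: "x * (6 * l + 2) < card S"
    if S: "S \<subseteq> V" "S \<noteq> {}" "card S \<le> ((4 * d) ^ l) ^ 4"
      and J: "J \<subseteq> I" "1 \<le> x" "card J = card S + x" "confined g S J" for S J x
  proof (rule ccontr)
    assume "\<not> ?thesis"
    \<comment> \<open>A violating x is at least the rounded-up quotient, so J can be shrunk to the
      exact size that \<open>P2\<close> counts.\<close>
    then have "card S + (6 * l + 1) < (x + 1) * (6 * l + 2)" by simp
    then have "r (card S) < x + 1" unfolding r_def by (rule less_mult_imp_div_less)
    then have "card S + r (card S) \<le> card J" using J(3) by simp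
    then obtain J' where J': "J' \<subseteq> J" "card J' = card S + r (card S)"
      by (rule obtain_subset_with_card_n)
    have "1 \<le> card S" using S finV by (metis Suc_leI card_gt_0_iff finite_subset One_nat_def)
    have "1 = (of_bool (confined g S J') :: real)" using J(4) J'(1) unfolding confined_def by auto
    also have "\<dots> \<le> (\<Sum>J | J \<subseteq> I \<and> card J = card S + r (card S). of_bool (confined g S J))"
      using J'  J(1) finI by (intro member_le_sum) auto
    also have "\<dots> \<le> (\<Sum>S' | S' \<subseteq> V \<and> card S' = card S.
        \<Sum>J | J \<subseteq> I \<and> card J = card S + r (card S). of_bool (confined g S' J))"
      using S finV by (intro member_le_sum[where f = "\<lambda>S'. \<Sum>J | J \<subseteq> I \<and> card J = card S + r (card S). of_bool (confined g S' J)"] sum_nonneg) auto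
    also have "\<dots> \<le> P2 g" unfolding P2_def
      using S(3) \<open>1 \<le> card S\<close>
      by (intro member_le_sum[where f = "\<lambda>s. \<Sum>S' | S' \<subseteq> V \<and> card S' = s.
        \<Sum>J | J \<subseteq> I \<and> card J = s + r s. of_bool (confined g S' J)"] sum_nonneg) auto
    finally show False using lt(2) by simp
  qed
  show ?thesis
  proof (intro bexI[of _ g] conjI)
    show "\<forall>f \<in> V \<rightarrow>\<^sub>E {1..k}. real (card {i \<in> I. f (fst (g i)) < f (snd (g i))})
        \<le> real (d * n) * (1/2 * (1 - 1 / real k) + \<epsilon> / 2)"
      using A unfolding lim_def by (rule ballI)
    show "\<forall>S J x. S \<subseteq> V \<and> S \<noteq> {} \<and> card S \<le> ((4 * d) ^ l) ^ 4 \<and> J \<subseteq> I \<and> 1 \<le> x \<and>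
        card J = card S + x \<and> confined g S J \<longrightarrow> x * (6 * l + 2) < card S"
      using B by blast
  qed (use g Y in \<open>simp_all only: Y1_def Y2_def\<close>)
qed

section \<open>The instance\<close>

text \<open>Deleting indices from a good assignment keeps the sparsity and only lowers the number of
  increasing arcs per labelling. What needs care is that the objective is normalized by the smaller
  number of surviving arcs, and that g becomes injective on the surviving indices, so that arcs can
  replace indices.\<close>

lemma exists_sparse_instance:
  fixes d l n k :: nat and \<epsilon> :: real
  assumes k: "2 \<le> k" and e: "0 < \<epsilon>" "\<epsilon> \<le> 1/2" and dk: "16 * ln (real k) \<le> real d * \<epsilon>\<^sup>2"
    and l: "1 \<le> l" and n: "((4 * d) ^ l) ^ 100 \<le> n" and d: "1 \<le> d"
  shows "\<exists>D :: nat pair_pre_digraph. ordering_instance D (\<lambda>_. 1) \<and> card (pverts D) = n \<and>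
     ordering_opt k D (\<lambda>_. 1) \<le> 1/2 * (1 - 1 / real k) + \<epsilon> \<and>
     max_mdegree (underlying_multigraph D) \<le> 8 * d \<and>
     3/4 * (real d * real n) \<le> real (card (medges (underlying_multigraph D))) \<and>
     (\<forall>S \<subseteq> mverts (underlying_multigraph D). card S \<le> ((4 * d) ^ l) ^ 4 \<longrightarrow>
        path_decomposable l (minduced (underlying_multigraph D) S))"
proof -
  define V where "V = {..<n}"
  define I where "I = {..<d * n}"
  define p where "p = 1/2 * (1 - 1 / real k)"
  have "\<exists>g \<in> I \<rightarrow>\<^sub>E V \<times> V.
     (\<forall>f \<in> V \<rightarrow>\<^sub>E {1..k}. real (card {i \<in> I. f (fst (g i)) < f (snd (g i))})
        \<le> real (d * n) * (p + \<epsilon> / 2)) \<and>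
     (\<forall>S J x. S \<subseteq> V \<and> S \<noteq> {} \<and> card S \<le> ((4 * d) ^ l) ^ 4 \<and> J \<subseteq> I \<and> 1 \<le> x \<and>
        card J = card S + x \<and> confined g S J \<longrightarrow> x * (6 * l + 2) < card S) \<and>
     (\<Sum>v\<in>V. incidences I g v * of_bool (8 * real d < incidences I g v)) +
       (\<Sum>s\<in>{1..2 * l + 1}. \<Sum>S | S \<subseteq> V \<and> card S = s.
          \<Sum>J | J \<subseteq> I \<and> card J = s. real s * of_bool (confined g S J))
       < \<epsilon> * real (d * n) / 2"
    unfolding V_def I_def p_def by (rule exists_good_assignment[OF k e dk l n])
  then obtain g where g: "g \<in> I \<rightarrow>\<^sub>E V \<times> V"
    and lab: "\<forall>f \<in> V \<rightarrow>\<^sub>E {1..k}. real (card {i \<in> I. f (fst (g i)) < f (snd (g i))})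
        \<le> real (d * n) * (p + \<epsilon> / 2)"
    and dense: "\<forall>S J x. S \<subseteq> V \<and> S \<noteq> {} \<and> card S \<le> ((4 * d) ^ l) ^ 4 \<and> J \<subseteq> I \<and> 1 \<le> x \<and>
        card J = card S + x \<and> confined g S J \<longrightarrow> x * (6 * l + 2) < card S"
    and few: "(\<Sum>v\<in>V. incidences I g v * of_bool (8 * real d < incidences I g v)) +
       (\<Sum>s\<in>{1..2 * l + 1}. \<Sum>S | S \<subseteq> V \<and> card S = s.
          \<Sum>J | J \<subseteq> I \<and> card J = s. real s * of_bool (confined g S J))
       < \<epsilon> * real (d * n) / 2"
    by (elim bexE conjE) (rule that)
  have finV: "finite V" and finI: "finite I" unfolding V_def I_def by auto
  have gV: "fst (g i) \<in> V" "snd (g i) \<in> V" if "i \<in> I" for i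
    using g that by (auto simp: PiE_iff mem_Times_iff)
  define high where "high v \<longleftrightarrow> 8 * real d < incidences I g v" for v
  define B1 where "B1 = {i \<in> I. high (fst (g i)) \<or> high (snd (g i))}"
  \<comment> \<open>Every index set with as many indices as the vertex set containing them is
    removed entirely, which destroys all short cycles at once.\<close>
  define B2 where "B2 = (\<Union>s\<in>{1..2 * l + 1}. \<Union>S\<in>{S. S \<subseteq> V \<and> card S = s}.
      \<Union>J\<in>{J. J \<subseteq> I \<and> card J = s}. if confined g S J then J else {})"
  define K where "K = I - (B1 \<union> B2)"
  define D where "D = \<lparr>pverts = V, parcs = g ` K\<rparr>"
  have KI: "K \<subseteq> I" and finK: "finite K" using finI unfolding K_def by auto
  have B2I: "B2 \<subseteq> I" unfolding B2_def by (auto split: if_splits)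
  have B1: "real (card B1) \<le> (\<Sum>v\<in>V. incidences I g v * of_bool (high v))"
  proof -
    have "real (card B1) = (\<Sum>i\<in>I. of_bool (high (fst (g i)) \<or> high (snd (g i))))"
      unfolding B1_def using finI by (rule real_card_Collect_eq_sum)
    also have "\<dots> \<le> (\<Sum>i\<in>I. \<Sum>v\<in>V. (of_bool (fst (g i) = v) + of_bool (snd (g i) = v)) * of_bool (high v))"
    proof (rule sum_mono)
      fix i assume i: "i \<in> I"
      have "(\<Sum>v\<in>V. (of_bool (fst (g i) = v) + of_bool (snd (g i) = v)) * of_bool (high v))
          = (\<Sum>v\<in>V. if fst (g i) = v then of_bool (high v) else 0) +
            (\<Sum>v\<in>V. if snd (g i) = v then of_bool (high v) else (0::real))"
        unfolding sum.distrib[symmetric] by (intro sum.cong) auto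
      also have "\<dots> = of_bool (high (fst (g i))) + of_bool (high (snd (g i)))"
        using finV gV[OF i] by simp
      finally show "of_bool (high (fst (g i)) \<or> high (snd (g i)))
          \<le> (\<Sum>v\<in>V. (of_bool (fst (g i) = v) + of_bool (snd (g i) = v)) * (of_bool (high v) :: real))"
        by auto
    qed
    also have "\<dots> = (\<Sum>v\<in>V. incidences I g v * of_bool (high v))"
      unfolding incidences_def by (subst sum.swap) (simp add: sum_distrib_right)
    finally show ?thesis .
  qed
  have B2: "real (card B2) \<le> (\<Sum>s\<in>{1..2 * l + 1}. \<Sum>S | S \<subseteq> V \<and> card S = s.
      \<Sum>J | J \<subseteq> I \<and> card J = s. real s * of_bool (confined g S J))"
  proof -
    have "card B2 \<le> (\<Sum>s\<in>{1..2 * l + 1}. \<Sum>S | S \<subseteq> V \<and> card S = s.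
      \<Sum>J | J \<subseteq> I \<and> card J = s. card (if confined g S J then J else {}))"
      unfolding B2_def
      by (rule order_trans[OF card_UN_le], simp, rule sum_mono,
          rule order_trans[OF card_UN_le], use finV in simp, rule sum_mono,
          rule card_UN_le, use finI in simp)
    also have "\<dots> = (\<Sum>s\<in>{1..2 * l + 1}. \<Sum>S | S \<subseteq> V \<and> card S = s.
      \<Sum>J | J \<subseteq> I \<and> card J = s. s * of_bool (confined g S J))"
      by (intro sum.cong refl) auto
    finally have "real (card B2) \<le> real \<dots>" by (rule of_nat_mono)
    then show ?thesis by (simp only: of_nat_sum of_nat_mult of_nat_of_bool)
  qed
  have Bsum: "real (card (B1 \<union> B2)) < \<epsilon> * real (d * n) / 2"
    using card_Un_le[of B1 B2] B1 B2 few unfolding high_def by linarith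
  have cardK: "real (d * n) - \<epsilon> * real (d * n) / 2 < real (card K)"
  proof -
    have "B1 \<union> B2 \<subseteq> I" using B2I unfolding B1_def by auto
    then have "card K = card I - card (B1 \<union> B2)" "card (B1 \<union> B2) \<le> card I"
      using finI unfolding K_def by (auto intro: card_Diff_subset card_mono finite_subset)
    then have "real (card K) = real (d * n) - real (card (B1 \<union> B2))" unfolding I_def by simp
    then show ?thesis using Bsum by linarith
  qed
  have short: False
    if "i \<in> K" "i \<in> J" "J \<subseteq> I" "S \<subseteq> V" "S \<noteq> {}" "card J = card S" "card S \<le> 2 * l + 1" "confined g S J" for i J S
  proof -
    have "1 \<le> card S" using that(4,5) finV by (metis Suc_leI card_gt_0_iff finite_subset One_nat_def)
    then have "i \<in> B2" unfolding B2_def using that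
      by (intro UN_I[of "card S"] UN_I[of S] UN_I[of J]) auto
    then show False using that(1) unfolding K_def by simp
  qed
  have loopfree: "fst (g i) \<noteq> snd (g i)" if i: "i \<in> K" for i
  proof
    assume "fst (g i) = snd (g i)"
    then have "confined g {fst (g i)} {i}" unfolding confined_def mem_Times_iff by simp
    then show False using short[OF i, of "{i}" "{fst (g i)}"] i KI gV[of i] l by auto
  qed
  \<comment> \<open>Two indices with the same image are confined to the two ends of that arc, a
    short dense set because 2 <= 2l + 1.\<close>
  have inj: "inj_on g K"
  proof (rule inj_onI, rule ccontr)
    fix i j assume i: "i \<in> K" and j: "j \<in> K" and eq: "g i = g j" and "i \<noteq> j"
    then have "confined g {fst (g i), snd (g i)} {i, j}" unfolding confined_def mem_Times_iff by auto
    moreover have "card {fst (g i), snd (g i)} = 2" "card {i, j} = 2" using loopfree[OF i] \<open>i \<noteq> j\<close> by auto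
    ultimately show False
      using short[OF i, of "{i, j}" "{fst (g i), snd (g i)}"] i j KI gV[of i] l by auto
  qed
  have "0 < ((4 * d) ^ l) ^ 100" using d by simp
  from this n have n0: "0 < n" by (rule less_le_trans)
  then have m0: "0 < real (d * n)" using d by simp
  have K0: "0 < real (card K)"
  proof -
    have "\<epsilon> * real (d * n) \<le> 1 * real (d * n)" using e by (intro mult_right_mono) auto
    then show ?thesis using cardK m0 by linarith
  qed
  have inst: "ordering_instance D (\<lambda>_. 1)"
    unfolding ordering_instance_def
  proof
    show "pair_digraph D"
      by unfold_locales (use gV KI loopfree finV finK in \<open>auto simp: D_def\<close>)
  qed simp
  have opt: "ordering_opt k D (\<lambda>_. 1) \<le> p + \<epsilon>"
  proof -
    have "ordering_value D (\<lambda>_. 1) f \<le> p + \<epsilon>" if f: "f \<in> V \<rightarrow>\<^sub>E {1..k}" for f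
    proof -
      have "{a \<in> g ` K. f (fst a) < f (snd a)} \<subseteq> g ` {i \<in> I. f (fst (g i)) < f (snd (g i))}"
        using KI by auto
      then have "card {a \<in> g ` K. f (fst a) < f (snd a)} \<le> card {i \<in> I. f (fst (g i)) < f (snd (g i))}"
        using finI by (intro surj_card_le) auto
      then have num: "real (card {a \<in> g ` K. f (fst a) < f (snd a)}) \<le> real (d * n) * (p + \<epsilon> / 2)"
        using lab f by fastforce
      have p: "0 \<le> p" "p \<le> 1/2" unfolding p_def using k by auto
      \<comment> \<open>This pays for the smaller denominator: more than (1 - \<epsilon>/2) dn arcs
        survive, and p + \<epsilon> <= 1 keeps the loss within the reserved \<epsilon>/2.\<close>
      have "p + \<epsilon> / 2 \<le> (1 - \<epsilon> / 2) * (p + \<epsilon>)"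
      proof -
        have "\<epsilon> * (p + \<epsilon>) \<le> \<epsilon> * 1" using p e by (intro mult_left_mono) auto
        moreover have "(1 - \<epsilon> / 2) * (p + \<epsilon>) = p + \<epsilon> - \<epsilon> * (p + \<epsilon>) / 2" by (simp add: algebra_simps)
        ultimately show ?thesis by linarith
      qed
      then have "real (d * n) * (p + \<epsilon> / 2) \<le> real (d * n) * ((1 - \<epsilon> / 2) * (p + \<epsilon>))"
        by (intro mult_left_mono) auto
      also have "\<dots> = (real (d * n) - \<epsilon> * real (d * n) / 2) * (p + \<epsilon>)" by (simp add: algebra_simps)
      also have "\<dots> \<le> real (card K) * (p + \<epsilon>)"
        using cardK p e by (intro mult_right_mono) auto
      finally have "real (card {a \<in> g ` K. f (fst a) < f (snd a)}) \<le> (p + \<epsilon>) * real (card K)"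
        using num by (simp add: mult.commute)
      then show ?thesis
        using K0 unfolding ordering_value_def D_def by (simp add: card_image[OF inj] pos_divide_le_eq)
    qed
    moreover have "finite (V \<rightarrow>\<^sub>E {1..k})" "V \<rightarrow>\<^sub>E {1..k} \<noteq> {}"
      using finV k by (auto intro: finite_PiE simp: PiE_eq_empty_iff)
    ultimately show ?thesis unfolding ordering_opt_def D_def by (auto simp: Max_le_iff)
  qed
  have deg: "max_mdegree (underlying_multigraph D) \<le> 8 * d"
  proof -
    have mdeg: "mdegree (underlying_multigraph D) v = card {a \<in> g ` K. v \<in> {fst a, snd a}}" for v
      unfolding mdegree_def underlying_multigraph_def D_def by simp
    \<comment> \<open>A high vertex has lost all its arcs; at any other vertex the incidences, which
      dominate the degree, are already at most 8d.\<close>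
    have "mdegree (underlying_multigraph D) v \<le> 8 * d" if "v \<in> V" for v
    proof (cases "high v")
      case True
      have "\<not> high (fst a) \<and> \<not> high (snd a)" if "a \<in> g ` K" for a
        using that unfolding K_def B1_def by blast
      then have "{a \<in> g ` K. v \<in> {fst a, snd a}} = {}" using True by blast
      then show ?thesis unfolding mdeg by (simp only: card.empty)
    next
      case False
      have "{a \<in> g ` K. v \<in> {fst a, snd a}} \<subseteq> g ` {i \<in> I. fst (g i) = v \<or> snd (g i) = v}"
        using KI by blast
      then have "card {a \<in> g ` K. v \<in> {fst a, snd a}} \<le> card {i \<in> I. fst (g i) = v \<or> snd (g i) = v}"
        using finI by (intro surj_card_le) auto
      moreover have "real (card {i \<in> I. fst (g i) = v \<or> snd (g i) = v}) \<le> incidences I g v"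
      proof -
        have "real (card {i \<in> I. fst (g i) = v \<or> snd (g i) = v})
            = (\<Sum>i\<in>I. of_bool (fst (g i) = v \<or> snd (g i) = v))"
          using finI by (rule real_card_Collect_eq_sum)
        also have "\<dots> \<le> incidences I g v" unfolding incidences_def by (intro sum_mono) auto
        finally show ?thesis .
      qed
      ultimately have "real (card {a \<in> g ` K. v \<in> {fst a, snd a}}) \<le> real (8 * d)"
        using False unfolding high_def of_nat_mult of_nat_numeral by linarith
      then show ?thesis unfolding mdeg by (simp only: of_nat_le_iff)
    qed
    moreover have "V \<noteq> {}" using n0 unfolding V_def by (auto simp: lessThan_empty_iff)
    ultimately show ?thesis using finV
      unfolding max_mdegree_def by (subst Max_le_iff) (auto simp: underlying_multigraph_def D_def)
  qed
  have edges: "3/4 * (real d * real n) \<le> real (card (medges (underlying_multigraph D)))"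
  proof -
    have "\<epsilon> * real (d * n) \<le> 1/2 * real (d * n)" using e by (intro mult_right_mono) auto
    then have "3/4 * real (d * n) \<le> real (card K)" using cardK by linarith
    then show ?thesis by (simp add: underlying_multigraph_def D_def card_image[OF inj])
  qed
  have sparse: "path_decomposable l (minduced (underlying_multigraph D) S)"
    if S: "S \<subseteq> V" "card S \<le> ((4 * d) ^ l) ^ 4" for S
  proof (rule path_decomposable_of_sparse)
    show "finite (parcs D)" "S \<subseteq> pverts D" using finK S unfolding D_def by auto
    \<comment> \<open>Arc sets pull back to index sets of the same size, since g is injective on K;
      this transfers the statements about confined indices to subgraphs of D.\<close>
    have J: "\<exists>J \<subseteq> K. card J = card F \<and> confined g W J" if "F \<subseteq> parcs D" "F \<subseteq> W \<times> W" for W F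
    proof -
      obtain J where J: "J \<subseteq> K" "F = g ` J" using \<open>F \<subseteq> parcs D\<close> unfolding D_def
        by (auto simp: subset_image_iff)
      then have "card F = card J" using inj_on_subset[OF inj] by (simp add: card_image)
      moreover have "confined g W J" using that(2) J(2) unfolding confined_def by blast
      ultimately show ?thesis using J by auto
    qed
    fix W F assume W: "W \<subseteq> S" "W \<noteq> {}" and F: "F \<subseteq> parcs D" "F \<subseteq> W \<times> W"
    from J[OF F] obtain J where J: "J \<subseteq> K" "card J = card F" "confined g W J" by blast
    have finS: "finite S" using S(1) finV by (rule finite_subset)
    have cW: "card W \<le> ((4 * d) ^ l) ^ 4" using card_mono[OF finS W(1)] S(2) by linarith
    {
      assume eq: "card F = card W"
      show "2 * l + 1 < card W"
      proof (rule ccontr)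
        assume "\<not> ?thesis"
        moreover have "card W \<noteq> 0" using W finS by (auto dest: finite_subset)
        then obtain i where "i \<in> J" using J(2) eq by fastforce
        ultimately show False
          using short[of i J W] J eq KI W S by auto
      qed
    next
      fix x assume "1 \<le> x" "card F = card W + x"
      then show "x * (6 * l + 2) < card W"
        using dense[rule_format, of W J x] W S J KI cW by auto
    }
  qed
  have "mverts (underlying_multigraph D) = V" "pverts D = V"
    unfolding underlying_multigraph_def D_def by auto
  then show ?thesis using inst opt deg edges sparse unfolding p_def V_def
    by (intro exI[of _ D]) auto
qed

section \<open>Choice of parameters\<close>

text \<open>From 1 - \<mu> <= exp(-\<mu>) and x >= L/200 the left side decays like exp(-\<mu> L /
  2000). Half of the exponent absorbs t, and the lower bound on L lets the other half absorb
  5/\<mu>.\<close>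

lemma noise_bound:
  fixes \<mu> L x t :: real
  assumes \<mu>: "0 < \<mu>" "\<mu> \<le> 1" and L: "4000 * ln (5 / \<mu>) / \<mu> \<le> L" and x: "L / 200 \<le> x"
    and t: "0 < t" "t < exp (\<mu> / 4000 * L)"
  shows "(1 - \<mu>) powr (x / 10) \<le> \<mu> / (5 * t)"
proof -
  have "0 \<le> ln (5 / \<mu>)" using \<mu> by (simp add: le_divide_eq)
  then have "0 \<le> 4000 * ln (5 / \<mu>) / \<mu>" using \<mu> by simp
  then have "0 \<le> x" using L x by simp
  have "(1 - \<mu>) powr (x / 10) \<le> exp (- \<mu>) powr (x / 10)"
    using \<mu> \<open>0 \<le> x\<close> exp_ge_add_one_self[of "- \<mu>"] by (intro powr_mono2) auto
  also have "\<dots> = exp (- (\<mu> * x / 10))" by (simp add: powr_def)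
  also have "\<dots> \<le> exp (- (\<mu> / 2000 * L))"
    using mult_left_mono[OF x, of \<mu>] \<mu> by simp
  finally have main: "(1 - \<mu>) powr (x / 10) \<le> exp (- (\<mu> / 2000 * L))" .
  have "ln (5 / \<mu>) \<le> \<mu> / 4000 * L" using L \<mu> by (simp add: field_simps)
  then have "exp (ln (5 / \<mu>)) \<le> exp (\<mu> / 4000 * L)" by simp
  then have five: "5 / \<mu> \<le> exp (\<mu> / 4000 * L)" using \<mu> by simp
  have "exp (- (\<mu> / 2000 * L)) * (5 * t) \<le> exp (- (\<mu> / 2000 * L)) * (5 * exp (\<mu> / 4000 * L))"
    using t by (intro mult_left_mono) auto
  also have "\<dots> = 5 * exp (- (\<mu> / 4000 * L))"
    by (simp flip: exp_add)
  also have "\<dots> \<le> \<mu>" using five \<mu> by (simp add: exp_minus field_simps)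
  finally have "exp (- (\<mu> / 2000 * L)) \<le> \<mu> / (5 * t)" using t by (simp add: pos_le_divide_eq)
  with main show ?thesis by linarith
qed

text \<open>(2\<Delta>)^l <= \<Delta>^(2l), and t < exp(\<gamma> L) <= exp l <= \<Delta>^l because
  \<gamma> L <= L/200 <= l. The product is at most \<Delta>^(3l), within the fourth power.\<close>

lemma sparse_set_size_le:
  fixes \<Delta> l c :: nat and \<gamma> L t :: real
  assumes \<Delta>: "4 \<le> \<Delta>" and L: "0 \<le> L" "L / 200 \<le> real l" and \<gamma>: "\<gamma> \<le> 1/200"
    and t: "0 < t" "t < exp (\<gamma> * L)" and c: "real c \<le> (2 * real \<Delta>) ^ l * t"
  shows "c \<le> (\<Delta> ^ l) ^ 4"
proof -
  define M where "M = real \<Delta> ^ l"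
  have M1: "1 \<le> M" unfolding M_def using \<Delta> by (intro one_le_power) auto
  have "2 * real \<Delta> \<le> real \<Delta> ^ 2"
    using \<Delta> mult_right_mono[of 2 "real \<Delta>" "real \<Delta>"] by (simp add: power2_eq_square)
  then have "(2 * real \<Delta>) ^ l \<le> (real \<Delta> ^ 2) ^ l" by (intro power_mono) auto
  also have "\<dots> = M ^ 2" unfolding M_def by (simp add: mult.commute flip: power_mult)
  finally have a: "(2 * real \<Delta>) ^ l \<le> M ^ 2" .
  have "\<gamma> * L \<le> 1/200 * L" using \<gamma> L by (intro mult_right_mono) auto
  then have "\<gamma> * L \<le> real l" using L by linarith
  then have "exp (\<gamma> * L) \<le> exp (real l)" by simp
  then have "t \<le> exp (real l)" using t by linarith
  also have "\<dots> = exp 1 ^ l" by (simp flip: exp_of_nat_mult)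
  also have "\<dots> \<le> real \<Delta> ^ l" using exp_le \<Delta> by (intro power_mono) auto
  finally have b: "t \<le> M" unfolding M_def .
  have "real c \<le> M ^ 2 * M"
    using c mult_mono[OF a b] t by simp
  also have "\<dots> = M ^ 3" by (simp add: power_Suc[symmetric] numeral_eq_Suc)
  also have "\<dots> \<le> M ^ 4" using M1 by (intro power_increasing) auto
  finally have "real c \<le> real ((\<Delta> ^ l) ^ 4)" unfolding M_def by simp
  then show ?thesis by (simp only: of_nat_le_iff)
qed

text \<open>Provides a threshold uniform in k: as \<Delta> <= K ln k <= K ln n, this ratio bounds ln
  n / ln \<Delta> from below for every k <= n.\<close>

lemma eventually_large_log_ratio:
  fixes K C :: real
  assumes "0 < K"
  shows "\<exists>N :: nat. \<forall>n\<ge>N. C \<le> ln (real n) / ln (K * ln (real n))"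
proof -
  have "filterlim (\<lambda>n :: nat. ln (real n) / ln (K * ln (real n))) at_top at_top"
    using assms by real_asymp
  then have "\<forall>\<^sub>F n :: nat in at_top. C \<le> ln (real n) / ln (K * ln (real n))"
    by (simp add: filterlim_at_top)
  then show ?thesis by (simp add: eventually_at_top_linorder)
qed

text \<open>The real target 16 ln k / (\<epsilon> s)^2 is at least 1, so rounding it up at most
  doubles it. Multiplying by 4 gives the constants 64 and 128.\<close>

lemma exists_suitable_d:
  fixes \<epsilon> s :: real
  assumes k: "2 \<le> k" and \<epsilon>: "0 < \<epsilon>" and s: "0 < s" and small: "\<epsilon> * s \<le> 1/2"
  obtains d :: nat where "1 \<le> d" "16 * ln (real k) \<le> real d * (\<epsilon> * s)\<^sup>2"
    "64 / s\<^sup>2 * (ln (real k) / \<epsilon>\<^sup>2) \<le> real (4 * d)" "real (4 * d) \<le> 128 / s\<^sup>2 * (ln (real k) / \<epsilon>\<^sup>2)"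
proof
  let ?x = "16 * ln (real k) / (\<epsilon> * s)\<^sup>2" and ?d = "nat \<lceil>16 * ln (real k) / (\<epsilon> * s)\<^sup>2\<rceil>"
  have pos: "0 < \<epsilon> * s" using \<epsilon> s by simp
  have "2/3 \<le> ln (2::real)" by (rule ln2_ge_two_thirds)
  also have "ln 2 \<le> ln (real k)" using k by simp
  finally have lnk: "2/3 \<le> ln (real k)" .
  have "(\<epsilon> * s)\<^sup>2 \<le> (1/2)\<^sup>2" using pos small by (intro power_mono) auto
  then have "(\<epsilon> * s)\<^sup>2 \<le> 16 * ln (real k)" using lnk by (simp add: power2_eq_square)
  then have x1: "1 \<le> ?x" using pos \<epsilon> s by (simp add: le_divide_eq)
  then have d: "?x \<le> real ?d" "real ?d \<le> ?x + 1" by linarith+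
  then show "1 \<le> ?d" using x1 by linarith
  show "16 * ln (real k) \<le> real ?d * (\<epsilon> * s)\<^sup>2"
    using d(1) pos \<epsilon> s by (simp add: pos_divide_le_eq)
  have "64 / s\<^sup>2 * (ln (real k) / \<epsilon>\<^sup>2) = 4 * ?x" by (simp add: power_mult_distrib)
  then show "64 / s\<^sup>2 * (ln (real k) / \<epsilon>\<^sup>2) \<le> real (4 * ?d)"
    using d unfolding of_nat_mult of_nat_numeral by linarith
  have "128 / s\<^sup>2 * (ln (real k) / \<epsilon>\<^sup>2) = 8 * ?x" by (simp add: power_mult_distrib)
  then show "real (4 * ?d) \<le> 128 / s\<^sup>2 * (ln (real k) / \<epsilon>\<^sup>2)"
    using d x1 unfolding of_nat_mult of_nat_numeral by linarith
qed

text \<open>L >= 200 ensures that rounding L/200 up stays below L/100, and l <= L/100 is the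
  logarithmic form of \<Delta>^(100 l) <= n.\<close>

lemma exists_suitable_l:
  fixes \<Delta> n :: nat
  defines "L \<equiv> ln (real n) / ln (real \<Delta>)"
  assumes \<Delta>: "2 \<le> \<Delta>" and L: "200 \<le> L"
  obtains l :: nat where "1 \<le> l" "L / 200 \<le> real l" "real l \<le> L / 100" "(\<Delta> ^ l) ^ 100 \<le> n"
proof
  let ?l = "nat \<lceil>L / 200\<rceil>"
  show l: "L / 200 \<le> real ?l" by linarith
  then show "1 \<le> ?l" using L by linarith
  show u: "real ?l \<le> L / 100" using L by linarith
  have ln\<Delta>: "0 < ln (real \<Delta>)" using \<Delta> by simp
  have n: "0 < real n" using L unfolding L_def by (cases n) auto
  have "real ((\<Delta> ^ ?l) ^ 100) = exp (100 * real ?l * ln (real \<Delta>))"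
    using \<Delta> exp_of_nat_mult[of "100 * ?l" "ln (real \<Delta>)"] by (simp add: mult.commute flip: power_mult)
  also have "\<dots> \<le> exp (L * ln (real \<Delta>))" using u ln\<Delta> by simp
  also have "\<dots> = real n" using ln\<Delta> n unfolding L_def by simp
  finally show "(\<Delta> ^ ?l) ^ 100 \<le> n" by (simp only: of_nat_le_iff)
qed

text \<open>ln \<Delta> <= ln K + ln ln k, and for k >= 3 the additive ln K is absorbed into a
  multiple of ln ln k >= ln ln 3 > 0. For k = 2 the iterated logarithm is negative.\<close>

lemma powr_log_scale_ge:
  fixes K \<gamma> :: real and n k \<Delta> :: nat
  assumes K: "0 < K" and \<gamma>: "0 \<le> \<gamma>" and n: "1 \<le> n" and k: "3 \<le> k" and \<Delta>: "2 \<le> \<Delta>"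
    and up: "real \<Delta> \<le> K * ln (real k)"
  shows "real n powr ((\<gamma> / (1 + \<bar>ln K\<bar> / ln (ln 3))) / ln (ln (real k))) \<le> real n powr (\<gamma> / ln (real \<Delta>))"
proof (rule powr_mono)
  let ?C = "1 + \<bar>ln K\<bar> / ln (ln 3)"
  have l3: "0 < ln (ln (3::real))" using ln3_gt_1 by (simp add: ln_gt_zero)
  have lk: "ln 3 \<le> ln (real k)" using k by simp
  then have lk1: "1 < ln (real k)" using ln3_gt_1 by linarith
  have llk: "ln (ln 3) \<le> ln (ln (real k))" using lk ln3_gt_1 by simp
  have ln\<Delta>: "0 < ln (real \<Delta>)" using \<Delta> by simp
  have "ln (real \<Delta>) \<le> ln (K * ln (real k))" using up \<Delta> by simp
  also have "\<dots> = ln K + ln (ln (real k))" using K lk1 by (simp add: ln_mult)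
  also have "\<dots> \<le> \<bar>ln K\<bar> * (ln (ln (real k)) / ln (ln 3)) + ln (ln (real k))"
  proof -
    have "1 \<le> ln (ln (real k)) / ln (ln 3)" using llk l3 by simp
    then have "\<bar>ln K\<bar> * 1 \<le> \<bar>ln K\<bar> * (ln (ln (real k)) / ln (ln 3))" by (intro mult_left_mono) auto
    then show ?thesis by linarith
  qed
  also have "\<dots> = ?C * ln (ln (real k))" by (simp add: algebra_simps)
  finally have "\<gamma> / (?C * ln (ln (real k))) \<le> \<gamma> / ln (real \<Delta>)"
    using \<gamma> ln\<Delta> by (intro divide_left_mono) auto
  then show "\<gamma> / ?C / ln (ln (real k)) \<le> \<gamma> / ln (real \<Delta>)" by simp
  show "1 \<le> real n" using n by simp
qed

theorem theorem9:
  fixes eps_max :: real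
  assumes "0 < eps_max"
  shows
    "\<exists>c1 > (0::real). \<exists>c2 > (0::real). \<exists>c3 > (0::real). \<exists>c4 > (0::real). \<exists>c5 > (0::real).
     \<forall>\<epsilon> \<mu> :: real. 0 < \<epsilon> \<and> \<epsilon> \<le> eps_max \<and> 0 < \<mu> \<and> \<mu> \<le> 1 \<longrightarrow>
     (\<exists>\<gamma> > (0::real). \<exists>\<delta> > (0::real). \<exists>N :: nat. \<forall>n \<ge> N. \<forall>k \<in> {2..n}.
      \<exists>(\<Delta> :: nat) (l :: nat) (D :: nat pair_pre_digraph) (w :: nat \<times> nat \<Rightarrow> real).
        2 \<le> \<Delta> \<and>
        c1 * (ln (real k) / \<epsilon>\<^sup>2) \<le> real \<Delta> \<and> real \<Delta> \<le> c2 * (ln (real k) / \<epsilon>\<^sup>2) \<and>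
        c3 * (ln (real n) / ln (real \<Delta>)) \<le> real l \<and> real l \<le> c4 * (ln (real n) / ln (real \<Delta>)) \<and>
        ordering_instance D w \<and> card (pverts D) = n \<and>
        ordering_opt k D w \<le> 1 / 2 * (1 - 1 / real k) + \<epsilon> \<and>
        max_mdegree (underlying_multigraph D) \<le> 2 * \<Delta> \<and>
        real (card (medges (underlying_multigraph D))) \<ge> c5 * (real \<Delta> * real n) \<and>
        (\<forall>t :: real. 0 < t \<and> t < real n powr (\<gamma> / ln (real \<Delta>)) \<longrightarrow>
          (\<forall>S \<subseteq> mverts (underlying_multigraph D). real (card S) \<le> (2 * real \<Delta>) ^ l * t \<longrightarrow>
             path_decomposable l (minduced (underlying_multigraph D) S))) \<and>
        (\<forall>t :: real. 0 < t \<and> t < real n powr (\<gamma> / ln (real \<Delta>)) \<longrightarrow>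
          (1 - \<mu>) powr (real l / 10) \<le> \<mu> / (5 * t)) \<and>
        (3 \<le> k \<longrightarrow>
          real n powr (\<gamma> / ln (real \<Delta>)) \<ge> real n powr (\<delta> / ln (ln (real k)))))"
proof -
  \<comment> \<open>The construction is run with \<epsilon> * s <= 1/2 in place of \<epsilon>. This
    costs only a factor 1/s^2 in the bounds on \<Delta>, and s depends on \<open>eps_max\<close>
    alone, so the \<Theta> constants are uniform in \<epsilon> and \<mu>.\<close>
  define s where "s = 1 / (2 * (eps_max + 1))"
  have s: "0 < s" "s \<le> 1" using assms unfolding s_def by auto
  have main: "\<exists>\<gamma> > (0::real). \<exists>\<delta> > (0::real). \<exists>N :: nat. \<forall>n \<ge> N. \<forall>k \<in> {2..n}.
      \<exists>(\<Delta> :: nat) (l :: nat) (D :: nat pair_pre_digraph) (w :: nat \<times> nat \<Rightarrow> real).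
        2 \<le> \<Delta> \<and>
        64 / s\<^sup>2 * (ln (real k) / \<epsilon>\<^sup>2) \<le> real \<Delta> \<and> real \<Delta> \<le> 128 / s\<^sup>2 * (ln (real k) / \<epsilon>\<^sup>2) \<and>
        1/200 * (ln (real n) / ln (real \<Delta>)) \<le> real l \<and> real l \<le> 1/100 * (ln (real n) / ln (real \<Delta>)) \<and>
        ordering_instance D w \<and> card (pverts D) = n \<and>
        ordering_opt k D w \<le> 1 / 2 * (1 - 1 / real k) + \<epsilon> \<and>
        max_mdegree (underlying_multigraph D) \<le> 2 * \<Delta> \<and>
        real (card (medges (underlying_multigraph D))) \<ge> 3/16 * (real \<Delta> * real n) \<and>
        (\<forall>t :: real. 0 < t \<and> t < real n powr (\<gamma> / ln (real \<Delta>)) \<longrightarrow>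
          (\<forall>S \<subseteq> mverts (underlying_multigraph D). real (card S) \<le> (2 * real \<Delta>) ^ l * t \<longrightarrow>
             path_decomposable l (minduced (underlying_multigraph D) S))) \<and>
        (\<forall>t :: real. 0 < t \<and> t < real n powr (\<gamma> / ln (real \<Delta>)) \<longrightarrow>
          (1 - \<mu>) powr (real l / 10) \<le> \<mu> / (5 * t)) \<and>
        (3 \<le> k \<longrightarrow>
          real n powr (\<gamma> / ln (real \<Delta>)) \<ge> real n powr (\<delta> / ln (ln (real k))))"
    if \<epsilon>: "0 < \<epsilon>" "\<epsilon> \<le> eps_max" and \<mu>: "0 < \<mu>" "\<mu> \<le> 1" for \<epsilon> \<mu> :: real
  proof -
    define K where "K = 128 / s\<^sup>2 / \<epsilon>\<^sup>2"
    \<comment> \<open>Exactly the exponent that the noise estimate allows for t.\<close>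
    define \<gamma> where "\<gamma> = \<mu> / 4000"
    define \<delta> where "\<delta> = \<gamma> / (1 + \<bar>ln K\<bar> / ln (ln 3))"
    \<comment> \<open>The value 200 serves the rounding of l, the other term the noise
      estimate.\<close>
    define C where "C = max 200 (4000 * ln (5 / \<mu>) / \<mu>)"
    have K: "0 < K" unfolding K_def using s \<epsilon> by simp
    have \<gamma>: "0 < \<gamma>" "\<gamma> \<le> 1/200" unfolding \<gamma>_def using \<mu> by auto
    have "0 < ln (ln (3::real))" using ln3_gt_1 by (simp add: ln_gt_zero)
    then have \<delta>: "0 < \<delta>" unfolding \<delta>_def using \<gamma> by (intro divide_pos_pos add_pos_nonneg) auto
    have small: "\<epsilon> * s \<le> 1/2" using \<epsilon> assms unfolding s_def by (simp add: field_simps)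
    have "\<epsilon> * s \<le> \<epsilon>" using mult_left_mono[OF s(2), of \<epsilon>] \<epsilon> by simp
    obtain N where N: "\<And>n. N \<le> n \<Longrightarrow> C \<le> ln (real n) / ln (K * ln (real n))"
      using eventually_large_log_ratio[OF K] by blast
    show ?thesis
    proof (rule exI[of _ \<gamma>], rule conjI[OF \<gamma>(1)], rule exI[of _ \<delta>], rule conjI[OF \<delta>],
        rule exI[of _ N], intro allI impI ballI)
      fix n k assume n: "N \<le> n" and "k \<in> {2..n}"
      then have k: "2 \<le> k" "k \<le> n" by auto
      obtain d where d: "1 \<le> d" "16 * ln (real k) \<le> real d * (\<epsilon> * s)\<^sup>2"
        "64 / s\<^sup>2 * (ln (real k) / \<epsilon>\<^sup>2) \<le> real (4 * d)" "real (4 * d) \<le> 128 / s\<^sup>2 * (ln (real k) / \<epsilon>\<^sup>2)"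
        using exists_suitable_d[OF k(1) \<epsilon>(1) s(1) small] .
      define \<Delta> where "\<Delta> = 4 * d"
      define L where "L = ln (real n) / ln (real \<Delta>)"
      have \<Delta>: "4 \<le> \<Delta>" unfolding \<Delta>_def using d by simp
      have up: "real \<Delta> \<le> K * ln (real k)" using d(4) unfolding \<Delta>_def K_def by simp
      also have "\<dots> \<le> K * ln (real n)" using k K by (intro mult_left_mono) auto
      finally have "ln (real \<Delta>) \<le> ln (K * ln (real n))" using \<Delta> by simp
      then have "ln (real n) / ln (K * ln (real n)) \<le> L"
        unfolding L_def using \<Delta> k by (intro divide_left_mono mult_pos_pos) (auto simp: ln_gt_zero intro: less_le_trans[of 0 "ln (real \<Delta>)"])
      then have CL: "C \<le> L" using N[OF n] by linarith
      then have L: "200 \<le> L" "4000 * ln (5 / \<mu>) / \<mu> \<le> L" unfolding C_def by auto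
      obtain l where l: "1 \<le> l" "L / 200 \<le> real l" "real l \<le> L / 100" "(\<Delta> ^ l) ^ 100 \<le> n"
        using exists_suitable_l[of \<Delta> n] \<Delta> L(1) unfolding L_def by auto
      obtain D :: "nat pair_pre_digraph" where D: "ordering_instance D (\<lambda>_. 1)" "card (pverts D) = n"
        "ordering_opt k D (\<lambda>_. 1) \<le> 1/2 * (1 - 1 / real k) + \<epsilon> * s"
        "max_mdegree (underlying_multigraph D) \<le> 8 * d"
        "3/4 * (real d * real n) \<le> real (card (medges (underlying_multigraph D)))"
        and sparse: "\<And>S. S \<subseteq> mverts (underlying_multigraph D) \<Longrightarrow> card S \<le> (\<Delta> ^ l) ^ 4 \<Longrightarrow>
          path_decomposable l (minduced (underlying_multigraph D) S)"
        using exists_sparse_instance[OF k(1) _ small d(2) l(1) l(4)[unfolded \<Delta>_def] d(1)] \<epsilon> s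
        unfolding \<Delta>_def by auto
      have powr_eq: "real n powr (\<gamma> / ln (real \<Delta>)) = exp (\<gamma> * L)"
        using k unfolding powr_def L_def by simp
      show "\<exists>(\<Delta> :: nat) (l :: nat) (D :: nat pair_pre_digraph) (w :: nat \<times> nat \<Rightarrow> real).
        2 \<le> \<Delta> \<and>
        64 / s\<^sup>2 * (ln (real k) / \<epsilon>\<^sup>2) \<le> real \<Delta> \<and> real \<Delta> \<le> 128 / s\<^sup>2 * (ln (real k) / \<epsilon>\<^sup>2) \<and>
        1/200 * (ln (real n) / ln (real \<Delta>)) \<le> real l \<and> real l \<le> 1/100 * (ln (real n) / ln (real \<Delta>)) \<and>
        ordering_instance D w \<and> card (pverts D) = n \<and>
        ordering_opt k D w \<le> 1 / 2 * (1 - 1 / real k) + \<epsilon> \<and>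
        max_mdegree (underlying_multigraph D) \<le> 2 * \<Delta> \<and>
        real (card (medges (underlying_multigraph D))) \<ge> 3/16 * (real \<Delta> * real n) \<and>
        (\<forall>t :: real. 0 < t \<and> t < real n powr (\<gamma> / ln (real \<Delta>)) \<longrightarrow>
          (\<forall>S \<subseteq> mverts (underlying_multigraph D). real (card S) \<le> (2 * real \<Delta>) ^ l * t \<longrightarrow>
             path_decomposable l (minduced (underlying_multigraph D) S))) \<and>
        (\<forall>t :: real. 0 < t \<and> t < real n powr (\<gamma> / ln (real \<Delta>)) \<longrightarrow>
          (1 - \<mu>) powr (real l / 10) \<le> \<mu> / (5 * t)) \<and>
        (3 \<le> k \<longrightarrow>
          real n powr (\<gamma> / ln (real \<Delta>)) \<ge> real n powr (\<delta> / ln (ln (real k))))"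
      proof (rule exI[of _ \<Delta>], rule exI[of _ l], rule exI[of _ D], rule exI[of _ "\<lambda>_. 1"],
          intro conjI allI impI; (elim conjE)?)
        show "2 \<le> \<Delta>" using \<Delta> by simp
        show "64 / s\<^sup>2 * (ln (real k) / \<epsilon>\<^sup>2) \<le> real \<Delta>" "real \<Delta> \<le> 128 / s\<^sup>2 * (ln (real k) / \<epsilon>\<^sup>2)"
          using d unfolding \<Delta>_def by auto
        show "1/200 * (ln (real n) / ln (real \<Delta>)) \<le> real l" "real l \<le> 1/100 * (ln (real n) / ln (real \<Delta>))"
          using l unfolding L_def by auto
        show "ordering_instance D (\<lambda>_. 1)" "card (pverts D) = n" by fact+
        show "ordering_opt k D (\<lambda>_. 1) \<le> 1 / 2 * (1 - 1 / real k) + \<epsilon>"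
          using D(3) \<open>\<epsilon> * s \<le> \<epsilon>\<close> by linarith
        show "max_mdegree (underlying_multigraph D) \<le> 2 * \<Delta>" using D(4) unfolding \<Delta>_def by simp
        show "3/16 * (real \<Delta> * real n) \<le> real (card (medges (underlying_multigraph D)))"
          using D(5) unfolding \<Delta>_def by simp
        show "path_decomposable l (minduced (underlying_multigraph D) S)"
          if "0 < t" "t < real n powr (\<gamma> / ln (real \<Delta>))" "S \<subseteq> mverts (underlying_multigraph D)"
            "real (card S) \<le> (2 * real \<Delta>) ^ l * t" for t S
          using that \<Delta> L l \<gamma> unfolding powr_eq by (intro sparse sparse_set_size_le[of \<Delta> L l \<gamma> t]) auto
        show "(1 - \<mu>) powr (real l / 10) \<le> \<mu> / (5 * t)"
          if "0 < t" "t < real n powr (\<gamma> / ln (real \<Delta>))" for t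
          using that(2)[unfolded powr_eq, unfolded \<gamma>_def] that(1) L(2) l(2) \<mu> by (intro noise_bound)
        show "real n powr (\<delta> / ln (ln (real k))) \<le> real n powr (\<gamma> / ln (real \<Delta>))" if "3 \<le> k"
          unfolding \<delta>_def using K \<gamma> k that \<Delta> up by (intro powr_log_scale_ge) auto
      qed
    qed
  qed
  show ?thesis
    \<comment> \<open>The value 3/16 is the surviving fraction 3/4 of the dn arcs, rewritten with d
      = \<Delta>/4.\<close>
    by (rule exI[of _ "64 / s\<^sup>2"], rule conjI, use s in simp,
        rule exI[of _ "128 / s\<^sup>2"], rule conjI, use s in simp,
        rule exI[of _ "1/200"], rule conjI, simp,
        rule exI[of _ "1/100"], rule conjI, simp,
        rule exI[of _ "3/16"], rule conjI, simp, intro allI impI main; elim conjE)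
qed

end
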